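(* Let $m\geq2$ and let $$H(S_1,\ldots,S_n):=\sum_{k=1}^{m-1}\sum_{|\alpha|=k}\overline{a}_\alpha S_\alpha^*+a_0I+\sum_{k=1}^{m-1}\sum_{|\alpha|=k}a_\alpha S_\alpha,\quad a_\alpha\in\mathbb{C},$$ be a selfadjoint element of $C^*(S_1,\ldots,S_n)$ such that $\|H(S_1,\ldots,S_n)\|\leq1$. Then the following statements hold. (i) $\left(\sum_{|\alpha|=k}|a_\alpha|^2\right)^{1/2}\leq(1-|a_0|)\cos\frac{\pi}{\left[\frac{m-1}{k}\right]+2}$ for $1\leq k\leq m-1$. (ii) $\sum_{k=0}^{m-1}\left\|\sum_{|\alpha|=k}|a_\alpha|T_\alpha\right\|\leq1$ for any $[T_1,\ldots,T_n]\in[B(\mathcal{H})^n]_{\gamma_m}$, where $\gamma_m\in(0,1]$ is the solution of the equation $\sum_{k=1}^{m-1}t^k\cos\frac{\pi}{\left[\frac{m-1}{k}\right]+2}=1$. Moreover, $\{\gamma_m\}$ is a strictly decreasing sequence which converges to $\frac12$. (iii) $\sum_{k=1}^{m-1}\left\|\sum_{|\alpha|=k}|\overline{a}_\alpha|T_\alpha^*\right\|+|a_0|+\sum_{k=1}^{m-1}\left\|\sum_{|\alpha|=k}|a_\alpha|T_\alpha\right\|\leq1$ for any $[T_1,\ldots,T_n]\in[B(\mathcal{H})^n]_{t_m}$, where $t_m\in(0,1]$ is the solution of the equation $\sum_{k=1}^{m-1}t^k\cos\frac{\pi}{\left[\frac{m-1}{k}\right]+2}=\frac12$. Moreover, $\{t_m\}$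 is a strictly decreasing sequence which converges to $\frac13$. In particular, if $r_1,\ldots,r_n\geq0$, then (iv) $\sum_{k=0}^{m-1}\left(\sum_{|\alpha|=k}|a_\alpha|r_\alpha\right)\leq1$ if $\|(r_1,\ldots,r_n)\|_2\leq\gamma_m$; (v) $|a_0|+2\sum_{k=1}^{m-1}\left(\sum_{|\alpha|=k}|a_\alpha|r_\alpha\right)\leq1$ if $\|(r_1,\ldots,r_n)\|_2\leq t_m$.
   Context: Let $n\ge1$, $H_n$ an $n$-dimensional complex Hilbert space with orthonormal basis $e_1,\dots,e_n$, and $F^2(H_n)=\bigoplus_{k\ge0}H_n^{\otimes k}$ (with $H_n^{\otimes0}=\mathbb{C}1$) the full Fock space. The left creation operators are $S_i\varphi=e_i\otimes\varphi$, $i=1,\dots,n$, and $C^*(S_1,\dots,S_n)$ is the $C^*$-algebra they generate (Cuntz–Toeplitz algebra). $\mathbb{F}_n^+$ is the unital free semigroup on $g_1,\dots,g_n$ with identity $g_0$; $|g_{i_1}\cdots g_{i_k}|=k$, $|g_0|=0$; sums are over $\alpha\in\mathbb{F}_n^+$. $T_\alpha:=T_{i_1}\cdots T_{i_k}$ for $\alpha=g_{i_1}\cdots g_{i_k}$ and $T_{g_0}:=I$ (similarly $S_\alpha$, and $r_\alpha$ for scalars); $T_\alpha^*:=(T_\alpha)^*$. $a_0:=a_{g_0}$. $\mathcal{H}$ is a Hilbert space, $B(\mathcal{H})$ is the algebra of bounded operators on it, and $[B(\mathcal{H})^n]_r:=\{(T_1,\ldots,T_n)\in B(\mathcal{H})^n:\|T_1T_1^*+\cdots+T_nT_n^*\|^{1/2}\le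 r\}$. $[x]$ is the integer part of $x$ and $\|\cdot\|_2$ the Euclidean norm.
   Formalization: For m = 2 the equation for γ_m reads t/2 = 1, which has no solution in (0,1]; here γ_m is the unique positive solution for every m ≥ 2 (so γ_2 = 2), and γ_m ≤ 1 is claimed only for m ≥ 3. *)

theory Defs
  imports "HOL-Analysis.Analysis"
begin

section \<open>Complex Hilbert spaces\<close>

class complex_vector = real_vector +
  fixes scaleC :: "complex \<Rightarrow> 'a \<Rightarrow> 'a"  (infixr "*\<^sub>C" 75)
  assumes scaleC_add_right: "c *\<^sub>C (x + y) = c *\<^sub>C x + c *\<^sub>C y"
    and scaleC_add_left: "(c + d) *\<^sub>C x = c *\<^sub>C x + d *\<^sub>C x"
    and scaleC_scaleC: "c *\<^sub>C d *\<^sub>C x = (c * d) *\<^sub>C x"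
    and scaleC_of_real: "complex_of_real r *\<^sub>C x = r *\<^sub>R x"

text \<open>The complex inner product is linear in its first argument. Its real part is the real
  inner product of \<^class>\<open>real_inner\<close>, so norm and topology are the ones induced by
  \<open>cinner\<close>: the norm of \<open>x\<close> is \<open>sqrt (Re (cinner x x))\<close>.\<close>

class complex_inner = complex_vector + real_inner +
  fixes cinner :: "'a \<Rightarrow> 'a \<Rightarrow> complex"
  assumes cinner_commute: "cinner x y = cnj (cinner y x)"
    and cinner_add_left: "cinner (x + y) z = cinner x z + cinner y z"
    and cinner_scaleC_left: "cinner (c *\<^sub>C x) y = c * cinner x y"
    and Re_cinner: "Re (cinner x y) = inner x y"

class chilbert_space = complex_inner + complete_space

lemma cinner_add_right: "cinner x (y + z) = cinner x y + cinner x (z :: 'a::complex_inner)"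
  by (metis cinner_add_left cinner_commute complex_cnj_add)

lemma cinner_scaleC_right: "cinner x (c *\<^sub>C y) = cnj c * cinner x (y :: 'a::complex_inner)"
  by (metis cinner_scaleC_left cinner_commute complex_cnj_mult)

lemma Im_cinner: "Im (cinner x y) = inner x (\<i> *\<^sub>C (y :: 'a::complex_inner))"
  by (simp add: Re_cinner[symmetric] cinner_scaleC_right)

lemma cinner_eqI:
  fixes x y :: "'a::complex_inner"
  assumes "\<And>z. cinner z x = cinner z y"
  shows "x = y"
proof -
  have "inner z x = inner z y" for z
    using assms[of z] by (metis Re_cinner)
  then show ?thesis by (metis vector_eq_rdot inner_commute)
qed

lemma norm_scaleC: "norm (c *\<^sub>C x) = cmod c * norm (x :: 'a::complex_inner)"
proof -
  have im: "Im (cinner x x) = 0"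
    using arg_cong[OF cinner_commute[of x x], of Im] by simp
  have "(norm (c *\<^sub>C x))\<^sup>2 = Re (cinner (c *\<^sub>C x) (c *\<^sub>C x))"
    by (simp add: Re_cinner power2_norm_eq_inner)
  also have "\<dots> = (cmod c)\<^sup>2 * Re (cinner x x)"
    unfolding cinner_scaleC_left cinner_scaleC_right mult.assoc[symmetric]
      complex_norm_square[symmetric]
    by (simp add: im cmod_power2) (simp add: power2_eq_square algebra_simps)
  also have "\<dots> = (cmod c * norm x)\<^sup>2"
    by (simp add: Re_cinner power2_norm_eq_inner power_mult_distrib)
  finally show ?thesis by (simp add: power2_eq_iff_nonneg)
qed


section \<open>Bounded operators on a complex Hilbert space\<close>

definition bounded_clinear :: "('a::complex_inner \<Rightarrow> 'a) \<Rightarrow> bool" where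
  "bounded_clinear f \<longleftrightarrow> bounded_linear f \<and> (\<forall>c x. f (c *\<^sub>C x) = c *\<^sub>C f x)"

typedef (overloaded) 'a bop = "{f :: 'a::complex_inner \<Rightarrow> 'a. bounded_clinear f}"
  morphisms bop_apply Bop
  by (rule exI[of _ "\<lambda>x. x"]) (simp add: bounded_clinear_def bounded_linear_ident)

setup_lifting type_definition_bop

lemma bop_eqI: "(\<And>x. bop_apply A x = bop_apply B x) \<Longrightarrow> A = B"
  by (simp add: bop_apply_inject[symmetric] ext)

lemma bounded_linear_bop_apply: "bounded_linear (bop_apply A)"
  using bop_apply[of A] by (simp add: bounded_clinear_def)

instantiation bop :: (complex_inner) complex_vector
begin

lift_definition zero_bop :: "'a bop" is "\<lambda>x. 0"
  by (auto simp: bounded_clinear_def, metis add_cancel_right_left scaleC_add_right)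
lift_definition plus_bop :: "'a bop \<Rightarrow> 'a bop \<Rightarrow> 'a bop" is "\<lambda>f g x. f x + g x"
  by (auto simp: bounded_clinear_def scaleC_add_right intro: bounded_linear_add)
lift_definition scaleC_bop :: "complex \<Rightarrow> 'a bop \<Rightarrow> 'a bop" is "\<lambda>c f x. c *\<^sub>C f x"
proof -
  fix c and f :: "'a \<Rightarrow> 'a"
  assume f: "bounded_clinear f"
  have "bounded_linear (\<lambda>x. c *\<^sub>C (x :: 'a))"
    by (rule bounded_linear_intro[of _ "cmod c"])
      (simp_all add: scaleC_add_right scaleC_of_real[symmetric] scaleC_scaleC norm_scaleC
        mult.commute)
  with f show "bounded_clinear (\<lambda>x. c *\<^sub>C f x)"
    by (auto simp: bounded_clinear_def scaleC_scaleC mult.commute intro: bounded_linear_compose)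
qed
lift_definition scaleR_bop :: "real \<Rightarrow> 'a bop \<Rightarrow> 'a bop" is "\<lambda>r f x. r *\<^sub>R f x"
  by (auto simp: bounded_clinear_def scaleC_of_real[symmetric] scaleC_scaleC mult.commute)
    (auto simp: scaleC_of_real intro: bounded_linear_compose bounded_linear_scaleR_right)
definition uminus_bop :: "'a bop \<Rightarrow> 'a bop" where "- A = (-1) *\<^sub>R (A :: 'a bop)"
definition minus_bop :: "'a bop \<Rightarrow> 'a bop \<Rightarrow> 'a bop" where "A - B = A + - (B :: 'a bop)"

instance
  by standard
    (unfold uminus_bop_def minus_bop_def,
      (transfer, simp add: algebra_simps scaleC_add_right scaleC_add_left scaleC_scaleC
        scaleC_of_real)+)

end

instantiation bop :: (complex_inner) real_normed_algebra
begin

lift_definition times_bop :: "'a bop \<Rightarrow> 'a bop \<Rightarrow> 'a bop" is "\<lambda>f g x. f (g x)"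
  by (auto simp: bounded_clinear_def intro: bounded_linear_compose)
lift_definition norm_bop :: "'a bop \<Rightarrow> real" is onorm .
definition sgn_bop :: "'a bop \<Rightarrow> 'a bop" where "sgn A = A /\<^sub>R norm (A :: 'a bop)"
definition dist_bop :: "'a bop \<Rightarrow> 'a bop \<Rightarrow> real" where "dist A B = norm (A - B :: 'a bop)"
definition uniformity_bop :: "('a bop \<times> 'a bop) filter" where
  "uniformity_bop = (INF e\<in>{0<..}. principal {(x, y). dist x (y :: 'a bop) < e})"
definition open_bop :: "'a bop set \<Rightarrow> bool" where
  "open_bop U = (\<forall>x\<in>U. \<forall>\<^sub>F (x', y) in uniformity. x' = x \<longrightarrow> (y :: 'a bop) \<in> U)"

instance
proof
  fix A B C :: "'a bop" and r :: real
  show "A * B * C = A * (B * C)" by transfer simp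
  show "(A + B) * C = A * C + B * C" by transfer simp
  show "A * (B + C) = A * B + A * C"
    by transfer (auto simp: bounded_clinear_def linear_simps)
  show "(r *\<^sub>R A) * B = r *\<^sub>R (A * B)" by transfer simp
  show "A * (r *\<^sub>R B) = r *\<^sub>R (A * B)"
    by transfer (auto simp: bounded_clinear_def linear_simps)
  show "sgn A = A /\<^sub>R norm A" by (rule sgn_bop_def)
  show "dist A B = norm (A - B)" by (rule dist_bop_def)
  show "(uniformity :: ('a bop \<times> 'a bop) filter)
      = (INF e\<in>{0<..}. principal {(x, y). dist x y < e})"
    by (rule uniformity_bop_def)
  show "open U \<longleftrightarrow> (\<forall>x\<in>U. \<forall>\<^sub>F (x', y) in uniformity. x' = x \<longrightarrow> y \<in> U)"
    for U :: "'a bop set"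
    by (rule open_bop_def)
  show "norm A = 0 \<longleftrightarrow> A = 0"
    by transfer (auto simp: bounded_clinear_def onorm_eq_0 fun_eq_iff)
  show "norm (A + B) \<le> norm A + norm B"
    by transfer (auto simp: bounded_clinear_def intro: onorm_triangle)
  show "norm (r *\<^sub>R A) = \<bar>r\<bar> * norm A"
    by transfer (auto simp: bounded_clinear_def onorm_scaleR)
  show "norm (A * B) \<le> norm A * norm B"
    by transfer (auto simp: bounded_clinear_def onorm_compose[unfolded o_def])
qed

end

text \<open>The zero space is allowed, so \<open>0 \<noteq> 1\<close> is not available in general.\<close>

instantiation bop :: (complex_inner) monoid_mult
begin

lift_definition one_bop :: "'a bop" is "\<lambda>x. x"
  by (simp add: bounded_clinear_def bounded_linear_ident)

instance by standard (transfer, simp)+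

end

text \<open>The adjoint exists by the Riesz representation theorem (completeness is assumed) and is
  unique, so the definite description is always well-defined.\<close>

definition adj :: "'a::chilbert_space bop \<Rightarrow> 'a bop" where
  "adj A = (THE B. \<forall>x y. cinner (bop_apply A x) y = cinner x (bop_apply B y))"

lemma adj_eqI:
  assumes "\<And>x y. cinner (bop_apply A x) y = cinner x (bop_apply B y)"
  shows "adj A = B"
  unfolding adj_def
proof (rule the_equality)
  show "\<forall>x y. cinner (bop_apply A x) y = cinner x (bop_apply B y)" using assms by blast
  fix C assume "\<forall>x y. cinner (bop_apply A x) y = cinner x (bop_apply C y)"
  then show "C = B" using assms by (intro bop_eqI cinner_eqI) metis
qed

text \<open>The \<open>C\<^sup>*\<close>-algebra generated by a set \<open>X\<close> of operators: the least norm-closed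
  \<open>*\<close>-subalgebra containing \<open>X\<close>.\<close>

definition star_subalgebra :: "'a::chilbert_space bop set \<Rightarrow> bool" where
  "star_subalgebra M \<longleftrightarrow> 0 \<in> M
    \<and> (\<forall>A\<in>M. \<forall>B\<in>M. A + B \<in> M \<and> A * B \<in> M)
    \<and> (\<forall>c. \<forall>A\<in>M. c *\<^sub>C A \<in> M) \<and> (\<forall>A\<in>M. adj A \<in> M)"

definition cstar_generated :: "'a::chilbert_space bop set \<Rightarrow> 'a bop set" where
  "cstar_generated X = \<Inter>{M. X \<subseteq> M \<and> star_subalgebra M \<and> closed M}"

text \<open>Elements of the free semigroup on \<open>g\<^sub>i\<close>, \<open>i :: 'n\<close>, are words, that is lists over \<open>'n\<close>;
  the empty word is the identity \<open>g\<^sub>0\<close>. For a word \<open>\<alpha>\<close>, \<open>opword T \<alpha>\<close> is the operator product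
  \<open>T\<^sub>\<alpha>\<close> and \<open>numword r \<alpha>\<close> the product \<open>r\<^sub>\<alpha>\<close> of numbers.\<close>

definition opword :: "('n \<Rightarrow> 'a::complex_inner bop) \<Rightarrow> 'n list \<Rightarrow> 'a bop" where
  "opword T \<alpha> = prod_list (map T \<alpha>)"

definition numword :: "real ^ 'n \<Rightarrow> 'n list \<Rightarrow> real" where
  "numword r \<alpha> = prod_list (map (\<lambda>i. r $ i) \<alpha>)"

definition row_ball :: "real \<Rightarrow> ('n::finite \<Rightarrow> 'a::chilbert_space bop) set" where
  "row_ball r = {T. sqrt (norm (\<Sum>i\<in>UNIV. T i * adj (T i))) \<le> r}"


section \<open>The full Fock space\<close>

lemma finite_words [simp]: "finite {\<alpha> :: 'n::finite list. length \<alpha> = k}"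
  using finite_lists_length_eq[of "UNIV :: 'n set" k] by simp

text \<open>\<open>H\<^sub>n\<close> is the space of complex vectors indexed by the finite type \<open>'n\<close>, with the standard
  orthonormal basis. Its \<open>k\<close>-fold tensor power has the orthonormal basis of the elementary
  tensors of basis vectors, one for each word of length \<open>k\<close>, and is therefore the space of
  complex vectors indexed by the words of length \<open>k\<close>. A family \<open>f\<close> indexed by all words thus
  has the homogeneous components \<open>(f \<alpha>)\<^bsub>|\<alpha>| = k\<^esub>\<close>, \<open>k \<ge> 0\<close>, and it belongs to the Hilbert space
  direct sum iff the squared norms of these components are summable over \<open>k\<close>.\<close>

definition comp_sq_norm :: "('n::finite list \<Rightarrow> complex) \<Rightarrow> nat \<Rightarrow> real" where
  "comp_sq_norm f k = (\<Sum>\<alpha> | length \<alpha> = k. (cmod (f \<alpha>))\<^sup>2)"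

definition comp_cinner ::
    "('n::finite list \<Rightarrow> complex) \<Rightarrow> ('n list \<Rightarrow> complex) \<Rightarrow> nat \<Rightarrow> complex" where
  "comp_cinner f g k = (\<Sum>\<alpha> | length \<alpha> = k. f \<alpha> * cnj (g \<alpha>))"

typedef (overloaded) 'n fock = "{f :: 'n::finite list \<Rightarrow> complex. summable (comp_sq_norm f)}"
  morphisms fock_coeff Fock
  by (rule exI[of _ "\<lambda>_. 0"]) (simp add: comp_sq_norm_def[abs_def])

setup_lifting type_definition_fock

lemma comp_sq_norm_nonneg: "0 \<le> comp_sq_norm f k"
  by (simp add: comp_sq_norm_def sum_nonneg)

lemma summable_coeff: "summable (comp_sq_norm (fock_coeff f))"
  using fock_coeff[of f] by simp

lemma comp_sq_norm_scale: "comp_sq_norm (\<lambda>\<alpha>. c * f \<alpha>) = (\<lambda>k. (cmod c)\<^sup>2 * comp_sq_norm f k)"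
  by (simp add: comp_sq_norm_def norm_mult power_mult_distrib sum_distrib_left fun_eq_iff)

lemma comp_sq_norm_add: "comp_sq_norm (\<lambda>\<alpha>. f \<alpha> + g \<alpha>) k \<le> 2 * comp_sq_norm f k + 2 * comp_sq_norm g k"
proof -
  have "(cmod (a + b))\<^sup>2 \<le> 2 * (cmod a)\<^sup>2 + 2 * (cmod b)\<^sup>2" for a b
  proof -
    have "(cmod (a + b))\<^sup>2 \<le> (cmod a + cmod b)\<^sup>2"
      by (simp add: norm_triangle_ineq power_mono)
    also have "\<dots> \<le> 2 * (cmod a)\<^sup>2 + 2 * (cmod b)\<^sup>2"
      using sum_squares_bound[of "cmod a" "cmod b"] by (simp add: power2_sum)
    finally show ?thesis .
  qed
  then show ?thesis
    unfolding comp_sq_norm_def sum_distrib_left sum.distrib[symmetric] by (intro sum_mono)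
qed

lemma summable_add:
  assumes "summable (comp_sq_norm f)" "summable (comp_sq_norm g)"
  shows "summable (comp_sq_norm (\<lambda>\<alpha>. f \<alpha> + g \<alpha>))"
proof (rule summable_comparison_test')
  show "summable (\<lambda>k. 2 * comp_sq_norm f k + 2 * comp_sq_norm g k)"
    by (intro Series.summable_add summable_mult assms)
  show "norm (comp_sq_norm (\<lambda>\<alpha>. f \<alpha> + g \<alpha>) k) \<le> 2 * comp_sq_norm f k + 2 * comp_sq_norm g k"
    if "0 \<le> k" for k
    using comp_sq_norm_add[of f g k] by (simp add: comp_sq_norm_nonneg)
qed

lemma norm_comp_cinner: "cmod (comp_cinner f g k) \<le> comp_sq_norm f k + comp_sq_norm g k"
proof -
  have "cmod (f \<alpha> * cnj (g \<alpha>)) \<le> (cmod (f \<alpha>))\<^sup>2 + (cmod (g \<alpha>))\<^sup>2" for \<alpha>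
    using sum_squares_bound[of "cmod (f \<alpha>)" "cmod (g \<alpha>)"]
      mult_nonneg_nonneg[OF norm_ge_zero[of "f \<alpha>"] norm_ge_zero[of "g \<alpha>"]]
    unfolding norm_mult complex_mod_cnj by linarith
  then show ?thesis
    unfolding comp_cinner_def comp_sq_norm_def sum.distrib[symmetric] by (intro sum_norm_le)
qed

lemma summable_comp_cinner: "summable (comp_cinner (fock_coeff f) (fock_coeff g))"
  by (rule summable_comparison_test'[OF Series.summable_add[OF summable_coeff summable_coeff]])
    (rule norm_comp_cinner)

lemma comp_cinner_self: "comp_cinner f f = (\<lambda>k. complex_of_real (comp_sq_norm f k))"
  by (simp add: comp_cinner_def comp_sq_norm_def complex_norm_square fun_eq_iff del: of_real_power)

instantiation fock :: (finite) complex_inner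
begin

lift_definition zero_fock :: "'a fock" is "\<lambda>_. 0" by (simp add: comp_sq_norm_def[abs_def])
lift_definition plus_fock :: "'a fock \<Rightarrow> 'a fock \<Rightarrow> 'a fock" is "\<lambda>f g \<alpha>. f \<alpha> + g \<alpha>"
  by (rule summable_add)
lift_definition scaleC_fock :: "complex \<Rightarrow> 'a fock \<Rightarrow> 'a fock" is "\<lambda>c f \<alpha>. c * f \<alpha>"
  by (simp add: comp_sq_norm_scale summable_mult)
definition scaleR_fock :: "real \<Rightarrow> 'a fock \<Rightarrow> 'a fock" where
  "r *\<^sub>R f = complex_of_real r *\<^sub>C (f :: 'a fock)"
definition uminus_fock :: "'a fock \<Rightarrow> 'a fock" where "- f = (-1) *\<^sub>C (f :: 'a fock)"
definition minus_fock :: "'a fock \<Rightarrow> 'a fock \<Rightarrow> 'a fock" where "f - g = f + - (g :: 'a fock)"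
definition cinner_fock :: "'a fock \<Rightarrow> 'a fock \<Rightarrow> complex" where
  "cinner f g = (\<Sum>k. comp_cinner (fock_coeff f) (fock_coeff g) k)"
definition inner_fock :: "'a fock \<Rightarrow> 'a fock \<Rightarrow> real" where
  "inner f g = Re (cinner f (g :: 'a fock))"
definition norm_fock :: "'a fock \<Rightarrow> real" where "norm f = sqrt (inner f (f :: 'a fock))"
definition sgn_fock :: "'a fock \<Rightarrow> 'a fock" where "sgn f = inverse (norm f) *\<^sub>R (f :: 'a fock)"
definition dist_fock :: "'a fock \<Rightarrow> 'a fock \<Rightarrow> real" where "dist f g = norm (f - g :: 'a fock)"
definition uniformity_fock :: "('a fock \<times> 'a fock) filter" where
  "uniformity_fock = (INF e\<in>{0<..}. principal {(x, y). dist x (y :: 'a fock) < e})"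
definition open_fock :: "'a fock set \<Rightarrow> bool" where
  "open_fock U = (\<forall>x\<in>U. \<forall>\<^sub>F (x', y) in uniformity. x' = x \<longrightarrow> (y :: 'a fock) \<in> U)"

instance
proof
  fix f g h :: "'a fock" and c d :: complex and r s :: real
  show add: "f + g + h = f + (g + h)" "f + g = g + f" "0 + f = f" "- f + f = 0" "f - g = f + - g"
    unfolding uminus_fock_def minus_fock_def by (transfer, simp add: algebra_simps)+
  show "r *\<^sub>R (f + g) = r *\<^sub>R f + r *\<^sub>R g" "(r + s) *\<^sub>R f = r *\<^sub>R f + s *\<^sub>R f"
    "r *\<^sub>R s *\<^sub>R f = (r * s) *\<^sub>R f" "1 *\<^sub>R f = f"
    unfolding scaleR_fock_def by (transfer, simp add: algebra_simps)+
  show "c *\<^sub>C (f + g) = c *\<^sub>C f + c *\<^sub>C g" "(c + d) *\<^sub>C f = c *\<^sub>C f + d *\<^sub>C f"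
    "c *\<^sub>C d *\<^sub>C f = (c * d) *\<^sub>C f"
    by (transfer, simp add: algebra_simps)+
  show "complex_of_real r *\<^sub>C f = r *\<^sub>R f" by (simp add: scaleR_fock_def)
  have cadd: "cinner (f + g) h = cinner f h + cinner g h" for f g h :: "'a fock"
    unfolding cinner_fock_def
    by (subst suminf_add[OF summable_comp_cinner summable_comp_cinner])
      (simp add: comp_cinner_def[abs_def] plus_fock.rep_eq algebra_simps sum.distrib)
  have cscale: "cinner (c *\<^sub>C f) g = c * cinner f g" for c and f g :: "'a fock"
    unfolding cinner_fock_def suminf_mult[OF summable_comp_cinner, symmetric]
    by (simp add: comp_cinner_def[abs_def] scaleC_fock.rep_eq algebra_simps sum_distrib_left)
  have ccomm: "cinner f g = cnj (cinner g f)" for f g :: "'a fock"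
  proof -
    have "(\<lambda>k. cnj (comp_cinner (fock_coeff g) (fock_coeff f) k)) sums cnj (cinner g f)"
      unfolding cinner_fock_def sums_cnj by (rule summable_sums[OF summable_comp_cinner])
    moreover have "(\<lambda>k. cnj (comp_cinner (fock_coeff g) (fock_coeff f) k)) = comp_cinner (fock_coeff f) (fock_coeff g)"
      by (simp add: comp_cinner_def fun_eq_iff mult.commute)
    ultimately show ?thesis unfolding cinner_fock_def[of f g] by (simp add: sums_iff)
  qed
  show "cinner f g = cnj (cinner g f)" by (rule ccomm)
  show "cinner (f + g) h = cinner f h + cinner g h" by (rule cadd)
  show "cinner (c *\<^sub>C f) g = c * cinner f g" by (rule cscale)
  show "Re (cinner f g) = inner f g" by (simp add: inner_fock_def)
  show "inner f g = inner g f" unfolding inner_fock_def by (subst ccomm) simp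
  show "inner (f + g) h = inner f h + inner g h" by (simp add: inner_fock_def cadd)
  show "inner (r *\<^sub>R f) g = r * inner f g" by (simp add: inner_fock_def scaleR_fock_def cscale)
  have self: "inner f f = (\<Sum>k. comp_sq_norm (fock_coeff f) k)" for f :: "'a fock"
    unfolding inner_fock_def cinner_fock_def comp_cinner_self
    by (simp add: suminf_of_real[OF summable_coeff, symmetric])
  show "0 \<le> inner f f"
    unfolding self by (intro suminf_nonneg summable_coeff comp_sq_norm_nonneg)
  show "inner f f = 0 \<longleftrightarrow> f = 0"
  proof
    assume "inner f f = 0"
    then have "comp_sq_norm (fock_coeff f) k = 0" for k
      unfolding self by (simp add: suminf_eq_zero_iff summable_coeff comp_sq_norm_nonneg)
    then have "fock_coeff f \<alpha> = 0" for \<alpha>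
      unfolding comp_sq_norm_def by (simp add: sum_nonneg_eq_0_iff)
    then show "f = 0" by transfer auto
  next
    assume "f = 0"
    then show "inner f f = 0"
      by (simp add: self zero_fock.rep_eq comp_sq_norm_def)
  qed
  show "norm f = sqrt (inner f f)" by (rule norm_fock_def)
  show "sgn f = inverse (norm f) *\<^sub>R f" by (rule sgn_fock_def)
  show "dist f g = norm (f - g)" by (rule dist_fock_def)
  show "(uniformity :: ('a fock \<times> 'a fock) filter)
      = (INF e\<in>{0<..}. principal {(x, y). dist x y < e})"
    by (rule uniformity_fock_def)
  show "open U \<longleftrightarrow> (\<forall>x\<in>U. \<forall>\<^sub>F (x', y) in uniformity. x' = x \<longrightarrow> y \<in> U)"
    for U :: "'a fock set"
    by (rule open_fock_def)
qed

end

lemma norm_fock_sq: "(norm f)\<^sup>2 = (\<Sum>k. comp_sq_norm (fock_coeff f) k)"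
proof -
  have "(norm f)\<^sup>2 = Re (cinner f f)" by (simp add: Re_cinner power2_norm_eq_inner)
  also have "\<dots> = (\<Sum>k. comp_sq_norm (fock_coeff f) k)"
    unfolding cinner_fock_def comp_cinner_self
    by (simp add: suminf_of_real[OF summable_coeff, symmetric])
  finally show ?thesis .
qed

lemma coeff_diff: "fock_coeff (f - g) = (\<lambda>\<alpha>. fock_coeff f \<alpha> - fock_coeff g \<alpha>)"
  by (simp add: fun_eq_iff minus_fock_def uminus_fock_def plus_fock.rep_eq scaleC_fock.rep_eq)

lemma cmod_coeff_le: "cmod (fock_coeff f \<alpha>) \<le> norm f"
proof -
  have "(cmod (fock_coeff f \<alpha>))\<^sup>2 \<le> comp_sq_norm (fock_coeff f) (length \<alpha>)"
    unfolding comp_sq_norm_def by (rule member_le_sum) auto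
  also have "\<dots> \<le> (norm f)\<^sup>2"
    unfolding norm_fock_sq
    using sum_le_suminf[OF summable_coeff, of "{length \<alpha>}"] by (simp add: comp_sq_norm_nonneg)
  finally show ?thesis by (simp add: power2_le_iff_abs_le)
qed

instance fock :: (finite) chilbert_space
proof
  fix X :: "nat \<Rightarrow> 'a fock"
  assume X: "Cauchy X"
  have "\<exists>l. (\<lambda>n. fock_coeff (X n) \<alpha>) \<longlonglongrightarrow> l" for \<alpha>
  proof -
    have "Cauchy (\<lambda>n. fock_coeff (X n) \<alpha>)"
      unfolding Cauchy_def
    proof (intro allI impI)
      fix e :: real assume "0 < e"
      then obtain M where "\<forall>m\<ge>M. \<forall>n\<ge>M. dist (X m) (X n) < e" using X by (meson Cauchy_def)
      then show "\<exists>M. \<forall>m\<ge>M. \<forall>n\<ge>M. dist (fock_coeff (X m) \<alpha>) (fock_coeff (X n) \<alpha>) < e"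
        unfolding dist_norm by (metis (no_types, lifting) coeff_diff cmod_coeff_le le_less_trans)
    qed
    then show ?thesis using Cauchy_convergent convergent_def by blast
  qed
  then obtain L where L: "\<And>\<alpha>. (\<lambda>n. fock_coeff (X n) \<alpha>) \<longlonglongrightarrow> L \<alpha>" by metis
  have bound: "\<exists>M. \<forall>n\<ge>M. \<forall>K. (\<Sum>k<K. comp_sq_norm (\<lambda>\<alpha>. fock_coeff (X n) \<alpha> - L \<alpha>) k) \<le> e\<^sup>2"
    if "0 < e" for e :: real
  proof -
    obtain M where M: "\<And>m n. m \<ge> M \<Longrightarrow> n \<ge> M \<Longrightarrow> dist (X m) (X n) < e"
      using X \<open>0 < e\<close> by (meson Cauchy_def)
    have "(\<Sum>k<K. comp_sq_norm (\<lambda>\<alpha>. fock_coeff (X n) \<alpha> - L \<alpha>) k) \<le> e\<^sup>2" if n: "n \<ge> M" for n K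
    proof (rule LIMSEQ_le_const2)
      show "(\<lambda>m. \<Sum>k<K. comp_sq_norm (fock_coeff (X n - X m)) k)
          \<longlonglongrightarrow> (\<Sum>k<K. comp_sq_norm (\<lambda>\<alpha>. fock_coeff (X n) \<alpha> - L \<alpha>) k)"
        unfolding comp_sq_norm_def coeff_diff by (intro tendsto_intros L)
      have "(\<Sum>k<K. comp_sq_norm (fock_coeff (X n - X m)) k) \<le> e\<^sup>2" if "m \<ge> M" for m
      proof -
        have "(\<Sum>k<K. comp_sq_norm (fock_coeff (X n - X m)) k) \<le> (norm (X n - X m))\<^sup>2"
          unfolding norm_fock_sq
          by (intro sum_le_suminf summable_coeff) (auto simp: comp_sq_norm_nonneg)
        also have "\<dots> \<le> e\<^sup>2"
          using M[OF n that] by (intro power_mono) (auto simp: dist_norm)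
        finally show ?thesis .
      qed
      then show "\<exists>N. \<forall>m\<ge>N. (\<Sum>k<K. comp_sq_norm (fock_coeff (X n - X m)) k) \<le> e\<^sup>2" by blast
    qed
    then show ?thesis by blast
  qed
  have summ: "summable (comp_sq_norm (\<lambda>\<alpha>. fock_coeff (X n) \<alpha> - L \<alpha>))"
    if "\<forall>K. (\<Sum>k<K. comp_sq_norm (\<lambda>\<alpha>. fock_coeff (X n) \<alpha> - L \<alpha>) k) \<le> e\<^sup>2" for n e
    using that by (intro summableI_nonneg_bounded[of _ "e\<^sup>2"]) (auto simp: comp_sq_norm_nonneg)
  have "summable (comp_sq_norm L)"
  proof -
    obtain n where n: "summable (comp_sq_norm (\<lambda>\<alpha>. fock_coeff (X n) \<alpha> - L \<alpha>))"
      using bound[of 1] summ[of _ 1] by (metis order_refl zero_less_one)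
    have "comp_sq_norm (\<lambda>\<alpha>. (-1) * (fock_coeff (X n) \<alpha> - L \<alpha>)) = comp_sq_norm (\<lambda>\<alpha>. fock_coeff (X n) \<alpha> - L \<alpha>)"
      unfolding comp_sq_norm_scale by simp
    with n have "summable (comp_sq_norm (\<lambda>\<alpha>. (-1) * (fock_coeff (X n) \<alpha> - L \<alpha>)))" by simp
    from summable_add[OF this summable_coeff[of "X n"]] show ?thesis by simp
  qed
  then have L': "fock_coeff (Fock L) = L" by (simp add: Fock_inverse)
  have "X \<longlonglongrightarrow> Fock L"
  proof (rule metric_LIMSEQ_I)
    fix e :: real assume "0 < e"
    then obtain M where M: "\<forall>n\<ge>M. \<forall>K. (\<Sum>k<K. comp_sq_norm (\<lambda>\<alpha>. fock_coeff (X n) \<alpha> - L \<alpha>) k) \<le> (e/2)\<^sup>2"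
      using bound[of "e/2"] by auto
    have "dist (X n) (Fock L) < e" if "n \<ge> M" for n
    proof -
      have "(norm (X n - Fock L))\<^sup>2 \<le> (e/2)\<^sup>2"
        unfolding norm_fock_sq using M that summ[of n "e/2"]
        by (intro suminf_le_const) (auto simp: coeff_diff L')
      then have "norm (X n - Fock L) \<le> e/2" using \<open>0 < e\<close> by (simp add: power2_le_iff_abs_le)
      then show ?thesis using \<open>0 < e\<close> by (simp add: dist_norm)
    qed
    then show "\<exists>M. \<forall>n\<ge>M. dist (X n) (Fock L) < e" by blast
  qed
  then show "convergent X" by (auto simp: convergent_def)
qed

text \<open>Tensor product in coordinates: for \<open>\<alpha>\<close> of length \<open>p\<close> and \<open>\<beta>\<close> of length \<open>q\<close>, the
  \<open>\<alpha>\<beta>\<close>-coordinate of \<open>\<xi> \<otimes> \<eta>\<close> with \<open>\<xi>\<close>, \<open>\<eta>\<close> homogeneous of degrees \<open>p\<close>, \<open>q\<close> is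
  \<open>\<xi>\<^sub>\<alpha> \<eta>\<^sub>\<beta>\<close>; this is extended bilinearly by summing over all factorizations of a word.\<close>

definition tensor :: "('n list \<Rightarrow> complex) \<Rightarrow> ('n list \<Rightarrow> complex) \<Rightarrow> ('n list \<Rightarrow> complex)" where
  "tensor f g = (\<lambda>w. \<Sum>j\<le>length w. f (take j w) * g (drop j w))"

definition basis_vec :: "'n \<Rightarrow> ('n list \<Rightarrow> complex)" where
  "basis_vec i = (\<lambda>w. if w = [i] then 1 else 0)"

lemma tensor_basis_Nil: "tensor (basis_vec i) f [] = 0"
  by (simp add: tensor_def basis_vec_def)

lemma tensor_basis_Cons: "tensor (basis_vec i) f (j # w) = (if j = i then f w else 0)"
proof -
  have *: "take l (j # w) = [i] \<longleftrightarrow> l = 1 \<and> j = i" if "l \<le> length (j # w)" for l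
    using that by (cases l) (auto simp: take_eq_Nil)
  have "tensor (basis_vec i) f (j # w)
      = (\<Sum>l\<le>length (j # w). if l = 1 then (if j = i then f w else 0) else 0)"
    unfolding tensor_def
    by (rule sum.cong[OF refl]) (simp only: atMost_iff basis_vec_def *, simp)
  also have "\<dots> = (if j = i then f w else 0)"
    by (subst sum.delta) simp_all
  finally show ?thesis .
qed

lemma comp_sq_norm_tensor_basis:
  "comp_sq_norm (tensor (basis_vec i) f) k = (case k of 0 \<Rightarrow> 0 | Suc l \<Rightarrow> comp_sq_norm f l)"
proof (cases k)
  case 0
  then show ?thesis by (simp add: comp_sq_norm_def tensor_basis_Nil)
next
  case (Suc l)
  have "comp_sq_norm (tensor (basis_vec i) f) (Suc l)
      = (\<Sum>w\<in>Cons i ` {v. length v = l}. (cmod (tensor (basis_vec i) f w))\<^sup>2)"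
    unfolding comp_sq_norm_def
  proof (rule sum.mono_neutral_right[OF finite_words])
    show "Cons i ` {v. length v = l} \<subseteq> {w. length w = Suc l}" by auto
    show "\<forall>w\<in>{w. length w = Suc l} - Cons i ` {v. length v = l}.
        (cmod (tensor (basis_vec i) f w))\<^sup>2 = 0"
    proof
      fix w assume w: "w \<in> {w. length w = Suc l} - Cons i ` {v. length v = l}"
      then obtain j v where "w = j # v" "length v = l" by (cases w) auto
      with w show "(cmod (tensor (basis_vec i) f w))\<^sup>2 = 0" by (auto simp: tensor_basis_Cons)
    qed
  qed
  also have "\<dots> = comp_sq_norm f l"
    by (subst sum.reindex) (simp_all add: tensor_basis_Cons comp_sq_norm_def)
  finally show ?thesis using Suc by simp
qed

lift_definition creation :: "'n::finite \<Rightarrow> 'n fock \<Rightarrow> 'n fock" is "\<lambda>i. tensor (basis_vec i)"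
proof -
  fix i and f :: "'n list \<Rightarrow> complex"
  assume "summable (comp_sq_norm f)"
  then have "summable (\<lambda>k. comp_sq_norm (tensor (basis_vec i) f) (Suc k))"
    by (simp add: comp_sq_norm_tensor_basis)
  then show "summable (comp_sq_norm (tensor (basis_vec i) f))"
    by (rule summable_Suc_iff[THEN iffD1])
qed

lemma norm_creation: "norm (creation i f) = norm f"
proof -
  have "(norm (creation i f))\<^sup>2
      = (\<Sum>k. comp_sq_norm (fock_coeff (creation i f)) (Suc k)) + comp_sq_norm (fock_coeff (creation i f)) 0"
    unfolding norm_fock_sq using suminf_split_head[OF summable_coeff] by (metis diff_add_cancel)
  also have "\<dots> = (norm f)\<^sup>2"
    unfolding norm_fock_sq by (simp add: creation.rep_eq comp_sq_norm_tensor_basis)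
  finally have "(norm (creation i f))\<^sup>2 = (norm f)\<^sup>2" .
  then show ?thesis by (simp add: power2_eq_iff_nonneg)
qed

text \<open>The left creation operators \<open>S\<^sub>i \<phi> = e\<^sub>i \<otimes> \<phi>\<close> as bounded operators.\<close>

lift_definition left_creation :: "'n::finite \<Rightarrow> 'n fock bop" is creation
proof -
  fix i :: 'n
  have add: "creation i (f + g) = creation i f + creation i g" for f g
    by transfer (simp add: tensor_def algebra_simps sum.distrib)
  have scale: "creation i (c *\<^sub>C f) = c *\<^sub>C creation i f" for c f
    by transfer (simp add: tensor_def algebra_simps sum_distrib_left)
  show "bounded_clinear (creation i)"
    unfolding bounded_clinear_def
    by (auto simp: add scale norm_creation scaleC_of_real[symmetric]
        intro!: bounded_linear_intro[of _ 1])
qed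

text \<open>The operator \<open>H(S\<^sub>1, \<dots>, S\<^sub>n)\<close>. Only the coefficients of words of length
  less than \<open>m\<close> are used.\<close>

definition toeplitz_poly :: "nat \<Rightarrow> ('n::finite list \<Rightarrow> complex) \<Rightarrow> 'n fock bop" where
  "toeplitz_poly m a =
     (\<Sum>k=1..m - 1. \<Sum>\<alpha> | length \<alpha> = k. cnj (a \<alpha>) *\<^sub>C adj (opword left_creation \<alpha>))
     + a [] *\<^sub>C 1
     + (\<Sum>k=1..m - 1. \<Sum>\<alpha> | length \<alpha> = k. a \<alpha> *\<^sub>C opword left_creation \<alpha>)"


section \<open>The radii\<close>

definition fejer_cos :: "nat \<Rightarrow> nat \<Rightarrow> real" where
  "fejer_cos m k = cos (pi / (real ((m - 1) div k) + 2))"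

definition fejer_sum :: "nat \<Rightarrow> real \<Rightarrow> real" where
  "fejer_sum m t = (\<Sum>k=1..m - 1. t ^ k * fejer_cos m k)"

text \<open>\<open>fejer_sum m\<close> is strictly increasing on \<open>{0..}\<close> for \<open>m \<ge> 2\<close>, so the positive solutions
  below are unique. The solution \<open>bohr_gamma m\<close> lies in \<open>{0<..1}\<close> only for \<open>m \<ge> 3\<close>: since
  \<open>fejer_sum 2 t = t / 2\<close>, it is \<open>2\<close> for \<open>m = 2\<close>, and this is why the range \<open>{0<..1}\<close> is not part
  of the definition. The solution \<open>bohr_t m\<close> lies in \<open>{0<..1}\<close> for all \<open>m \<ge> 2\<close>.\<close>

definition bohr_gamma :: "nat \<Rightarrow> real" where
  "bohr_gamma m = (THE t. 0 < t \<and> fejer_sum m t = 1)"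

definition bohr_t :: "nat \<Rightarrow> real" where
  "bohr_t m = (THE t. 0 < t \<and> fejer_sum m t = 1 / 2)"

end

(* Choose b = a_k / |a_k| on words of length k. Then V = sum of b_alpha S_alpha is an isometry whose
   orbit of the vacuum is orthonormal, and on the waves x_L = sum_{j<L} cis(-j t) V^j 1 the quadratic
   form of H, divided by L, tends to a trigonometric polynomial of degree N = [(m-1)/k] with mean a_0
   and first coefficient |a_k|. It is bounded by 1, so adding or subtracting it from 1 leaves a
   nonnegative trigonometric polynomial with mean 1 - |a_0|. The Egervary-Szasz estimate of its first
   coefficient comes from averaging over the M = N + 2 roots of z^M = -1 with the weights
   cos(pi/M) - cos(theta), which are nonnegative at these nodes. This gives (i); the other
   inequalities follow by Cauchy-Schwarz because the row (T_alpha)_{|alpha| = k} has norm at most r^k. *)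

theory Submission
  imports Defs
begin

section \<open>Nonnegative trigonometric polynomials\<close>

text \<open>The operator \<open>H\<close> involves noncommuting isometries, whereas the cosine bound
  is a one-variable fact. The orbit of the vacuum under V bridges the gap: there \<open>H\<close>
  has a Toeplitz matrix, because degrees rule out all words whose length is not a multiple of k, and
  adjoints of the remaining words turn powers of V into scalars. The choice of b is the equality
  case of Cauchy-Schwarz, which is why the first coefficient is the whole norm |a_k|. Truncated
  waves are needed because the infinite plane wave, which would evaluate the symbol at a point, is
  not square summable. The constants 1/2 and 1/3 are the solutions of t/(1 - t) = c for c = 1 and c
  = 1/2: as m grows the cosines tend to 1 and the sums become geometric series. In (ii) and (iv) one
  sum has to fit into 1 - |a_0|; in (iii) and (v) two have to, hence the halved right-hand
  side.\<close>

lemma sum_cis_roots_minus_one: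
  fixes q :: int
  assumes "M > 0" "\<bar>q\<bar> < int M" "q \<noteq> 0"
  shows "(\<Sum>j<M. cis (of_int q * ((2 * real j + 1) * pi / real M))) = 0"
proof -
  define z where "z = cis (2 * pi * of_int q / real M)"
  \<comment> \<open>The phase of the first node splits off and leaves a geometric sum whose ratio
    \<open>z\<close> is an \<open>M\<close>-th root of unity; \<open>z = 1\<close> would force
    \<open>M\<close> to divide \<open>q\<close>.\<close>
  have eq: "cis (of_int q * ((2 * real j + 1) * pi / real M)) = cis (of_int q * pi / real M) * z ^ j" for j
  proof -
    have "of_int q * ((2 * real j + 1) * pi / real M) = of_int q * pi / real M + real j * (2 * pi * of_int q / real M)"
      by (simp add: add_divide_distrib[symmetric] algebra_simps)
    then show ?thesis by (simp only: z_def Complex.DeMoivre cis_mult)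
  qed
  have "z \<noteq> 1"
  proof
    assume "z = 1"
    then obtain k :: int where k: "2 * pi * of_int q / real M = of_int k * (2 * pi)"
      unfolding z_def cis_conv_exp exp_eq_1 by (auto simp: mult_ac)
    then have "real_of_int q = of_int (k * int M)"
      using assms by (simp add: field_simps)
    then have "q = k * int M" by (simp only: of_int_eq_iff)
    then have "int M dvd q" by simp
    then show False
      using assms dvd_imp_le_int[of q "int M"] by simp
  qed
  moreover have "z ^ M = 1"
  proof -
    have "z ^ M = cis (2 * pi * of_int q)" using assms by (simp add: z_def Complex.DeMoivre)
    then show ?thesis by (simp add: cis_multiple_2pi)
  qed
  ultimately have "(\<Sum>j<M. z ^ j) = 0"
    by (simp add: geometric_sum)
  then show ?thesis
    unfolding eq sum_distrib_left[symmetric] by simp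
qed

text \<open>The cosine weight raises the degree from \<open>N\<close> to \<open>N + 1\<close>, so
  \<open>N + 2\<close> equally spaced nodes still average the product exactly. The factor 2 appears
  because taking the real part halves the Fourier coefficient \<open>c 1\<close>.\<close>

lemma nonneg_trig_poly_coeff_bound:
  fixes c :: "nat \<Rightarrow> complex"
  assumes N: "N \<ge> 1"
    and nonneg: "\<And>\<theta>. 0 \<le> c0 + Re (\<Sum>q=1..N. c q * cis (real q * \<theta>))"
  shows "cmod (c 1) \<le> 2 * c0 * cos (pi / (real N + 2))"
proof -
  define M where "M = N + 2"
  have M: "M > 0" "real M = real N + 2" by (auto simp: M_def)
  \<comment> \<open>Rotating by the argument of \<open>c 1\<close> turns the first coefficient into
    the nonnegative number \<open>cmod (c 1)\<close>.\<close>
  define \<phi> where "\<phi> = Arg (c 1)"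
  define t where "t j = (2 * real j + 1) * pi / real M" for j :: nat
  define C where "C = cos (pi / real M)"
  define f where "f j = c0 + Re (\<Sum>q=1..N. c q * cis (real q * (t j - \<phi>)))" for j
  define b where "b q = c q * cis (- (real q * \<phi>))" for q
  have b1: "b 1 = of_real (cmod (c 1))"
  proof (cases "c 1 = 0")
    case False
    then have "c 1 = of_real (cmod (c 1)) * cis \<phi>"
      unfolding \<phi>_def by (metis cis_Arg sgn_eq norm_eq_zero of_real_eq_0_iff nonzero_mult_div_cancel_left times_divide_eq_right)
    then have "b 1 = of_real (cmod (c 1)) * (cis \<phi> * cis (-\<phi>))"
      unfolding b_def by (metis mult.assoc mult_1 of_nat_1)
    then show ?thesis by (simp add: cis_mult)
  qed (simp add: b_def)
  have root: "(\<Sum>j<M. cis (of_int q * t j)) = 0" if "\<bar>q\<bar> < int M" "q \<noteq> 0" for q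
    unfolding t_def using sum_cis_roots_minus_one[OF M(1) that] .
  have f: "f j = c0 + Re (\<Sum>q=1..N. b q * cis (real_of_int (int q) * t j))" for j
    unfolding f_def b_def
    by (intro arg_cong[of _ _ "\<lambda>z. c0 + Re z"] sum.cong refl)
      (simp add: mult.assoc cis_mult algebra_simps)
  \<comment> \<open>The half-step offset keeps every node at distance at least \<open>pi / M\<close>
    from the multiples of \<open>2 * pi\<close>; the first and the last node attain it.\<close>
  have cosle: "cos (t j) \<le> C" if "j < M" for j
  proof -
    have lo: "pi / real M \<le> t j" "t j \<le> 2 * pi - pi / real M"
    proof -
      have "real j + 1 \<le> real M" using that by linarith
      then have "(2 * real j + 1) * pi \<le> (2 * real M - 1) * pi" by (intro mult_right_mono) auto
      then have "t j \<le> (2 * real M - 1) * pi / real M"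
        unfolding t_def by (intro divide_right_mono) auto
      also have "\<dots> = 2 * pi - pi / real M"
        using M(1) by (simp add: left_diff_distrib diff_divide_distrib)
      finally show "t j \<le> 2 * pi - pi / real M" .
      show "pi / real M \<le> t j"
        unfolding t_def by (intro divide_right_mono) (auto simp: algebra_simps)
    qed
    show ?thesis
    proof (cases "t j \<le> pi")
      case True
      then show ?thesis unfolding C_def using lo M by (intro cos_monotone_0_pi_le) auto
    next
      case False
      have "cos (2 * pi - t j) \<le> C"
        unfolding C_def using lo M False by (intro cos_monotone_0_pi_le) auto
      then show ?thesis by simp
    qed
  qed
  have s1: "(\<Sum>j<M. f j) = M * c0"
  proof -
    have "(\<Sum>j<M. b q * cis (real_of_int (int q) * t j)) = 0" if "q \<in> {1..N}" for q
      unfolding sum_distrib_left[symmetric] using root[of "int q"] that by (simp add: M_def)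
    then have "(\<Sum>q=1..N. \<Sum>j<M. b q * cis (real_of_int (int q) * t j)) = 0"
      by (rule sum.neutral[OF ballI])
    then have "(\<Sum>j<M. \<Sum>q=1..N. b q * cis (real_of_int (int q) * t j)) = 0"
      by (subst sum.swap)
    then show ?thesis
      unfolding f sum.distrib Re_sum[symmetric] by simp
  qed
  have cos_cis: "complex_of_real (cos x) = (cis x + cis (- x)) / 2" for x
    by (simp add: complex_eq_iff)
  \<comment> \<open>The cosine shifts frequency \<open>q\<close> to \<open>q + 1\<close> and
    \<open>q - 1\<close>. The former lies strictly between 0 and \<open>M\<close>, the latter is 0
    only for \<open>q = 1\<close>, so only that coefficient survives, with weight one half.\<close>
  have s2: "(\<Sum>j<M. cos (t j) * f j) = M / 2 * cmod (c 1)"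
  proof -
    have r1: "(\<Sum>j<M. cis (t j)) = 0" using root[of 1] by (simp add: M_def)
    then have "(\<Sum>j<M. cos (t j)) = Re 0" by (metis (mono_tags, lifting) Re_sum cis.sel(1) sum.cong)
    then have z: "(\<Sum>j<M. cos (t j) * c0) = 0" by (simp add: sum_distrib_right[symmetric])
    have p: "(\<Sum>j<M. of_real (cos (t j)) * cis (real_of_int (int q) * t j)) = (if q = 1 then of_nat M / 2 else 0)"
      if q: "q \<in> {1..N}" for q
    proof -
      have "of_real (cos (t j)) * cis (real_of_int (int q) * t j)
          = (cis (real_of_int (int q + 1) * t j) + cis (real_of_int (int q - 1) * t j)) / 2" for j
        unfolding cos_cis by (simp add: cis_mult algebra_simps add_divide_distrib)
      then have "(\<Sum>j<M. of_real (cos (t j)) * cis (real_of_int (int q) * t j))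
         = ((\<Sum>j<M. cis (real_of_int (int q + 1) * t j)) + (\<Sum>j<M. cis (real_of_int (int q - 1) * t j))) / 2"
        by (simp only: sum.distrib sum_divide_distrib[symmetric])
      also have "(\<Sum>j<M. cis (real_of_int (int q + 1) * t j)) = 0"
        by (rule root) (use q in \<open>auto simp: M_def\<close>)
      also have "(\<Sum>j<M. cis (real_of_int (int q - 1) * t j)) = (if q = 1 then of_nat M else 0)"
      proof (cases "q = 1")
        case False
        then show ?thesis using root[of "int q - 1"] q by (auto simp: M_def)
      qed simp
      finally show ?thesis by (cases "q = 1") (simp_all del: of_int_of_nat_eq)
    qed
    have "(\<Sum>j<M. of_real (cos (t j)) * (\<Sum>q=1..N. b q * cis (real_of_int (int q) * t j)))
        = (\<Sum>q=1..N. b q * (\<Sum>j<M. of_real (cos (t j)) * cis (real_of_int (int q) * t j)))"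
      unfolding sum_distrib_left by (subst sum.swap) (simp add: mult_ac)
    also have "\<dots> = (\<Sum>q=1..N. if q = 1 then b q * (of_nat M / 2) else 0)"
      by (intro sum.cong refl) (simp add: p del: of_int_of_nat_eq)
    also have "\<dots> = b 1 * (of_nat M / 2)" using N by (subst sum.delta) auto
    finally have e: "(\<Sum>j<M. of_real (cos (t j)) * (\<Sum>q=1..N. b q * cis (real_of_int (int q) * t j))) = of_real (cmod (c 1) * M / 2)"
      unfolding b1 by simp
    have "(\<Sum>j<M. cos (t j) * f j)
        = (\<Sum>j<M. cos (t j) * c0) + Re (\<Sum>j<M. of_real (cos (t j)) * (\<Sum>q=1..N. b q * cis (real_of_int (int q) * t j)))"
      unfolding f Re_sum[of _ "{..<M}"] Re_complex_of_real sum.distrib[symmetric] by (simp add: algebra_simps)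
    then show ?thesis unfolding z e by simp
  qed
  have "0 \<le> (\<Sum>j<M. (C - cos (t j)) * f j)"
    unfolding f_def by (intro sum_nonneg mult_nonneg_nonneg nonneg) (use cosle in auto)
  also have "\<dots> = C * (\<Sum>j<M. f j) - (\<Sum>j<M. cos (t j) * f j)"
    by (simp add: left_diff_distrib sum_subtractf sum_distrib_left)
  also have "\<dots> = M * (C * c0 - cmod (c 1) / 2)"
    unfolding s1 s2 by (simp add: algebra_simps)
  finally have "0 \<le> C * c0 - cmod (c 1) / 2"
    using M(1) by (simp add: zero_le_mult_iff)
  then show ?thesis unfolding C_def M(2) by (simp add: algebra_simps)
qed

section \<open>The radii\<close>

lemma fejer_cos_mono:
  assumes "i \<le> j"
  shows "fejer_cos i k \<le> fejer_cos j k"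
proof -
  have "(i - 1) div k \<le> (j - 1) div k" using assms by (intro div_le_mono) auto
  then have "real ((i - 1) div k) \<le> real ((j - 1) div k)" by simp
  then have "pi / (real ((j - 1) div k) + 2) \<le> pi / (real ((i - 1) div k) + 2)"
    by (intro divide_left_mono) auto
  moreover have "pi / (real ((i - 1) div k) + 2) \<le> pi" by (simp add: field_simps)
  ultimately show ?thesis
    unfolding fejer_cos_def by (intro cos_monotone_0_pi_le) auto
qed

lemma fejer_cos_le_one: "fejer_cos m k \<le> 1"
  by (simp add: fejer_cos_def)

text \<open>The quotient \<open>(m - 1) div k\<close> is at least 1 here, so the angle is at most
  \<open>pi / 3\<close>. This uniform bound supplies all positivity needed for the radii.\<close>

lemma fejer_cos_ge_half:
  assumes "k \<in> {1..m - 1}"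
  shows "1 / 2 \<le> fejer_cos m k"
proof -
  have "1 \<le> (m - 1) div k" using assms by (simp add: div_greater_zero_iff Suc_le_eq)
  then have "1 \<le> real ((m - 1) div k)" by simp
  then have "pi / (real ((m - 1) div k) + 2) \<le> pi / 3"
    by (intro divide_left_mono) auto
  then have "cos (pi / 3) \<le> fejer_cos m k"
    unfolding fejer_cos_def by (intro cos_monotone_0_pi_le) auto
  then show ?thesis by (simp add: cos_60)
qed

lemma fejer_cos_tendsto:
  assumes "k \<ge> 1"
  shows "(\<lambda>m. fejer_cos m k) \<longlonglongrightarrow> 1"
proof -
  have "filterlim (\<lambda>m. (m - 1) div k) at_top sequentially"
    unfolding filterlim_at_top
  proof
    fix Z :: nat
    show "\<forall>\<^sub>F m in sequentially. Z \<le> (m - 1) div k"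
      using eventually_ge_at_top[of "Z * k + 1"]
      by eventually_elim (use assms in \<open>auto simp: less_eq_div_iff_mult_less_eq\<close>)
  qed
  then have "filterlim (\<lambda>m. real ((m - 1) div k)) at_top sequentially"
    by (rule filterlim_compose[OF filterlim_real_sequentially])
  then have "filterlim (\<lambda>m. real ((m - 1) div k) + 2) at_top sequentially"
    by (subst add.commute) (rule filterlim_tendsto_add_at_top[OF tendsto_const])
  then have "(\<lambda>m. pi / (real ((m - 1) div k) + 2)) \<longlonglongrightarrow> 0"
    by (intro real_tendsto_divide_at_top[OF tendsto_const])
  then have "(\<lambda>m. cos (pi / (real ((m - 1) div k) + 2))) \<longlonglongrightarrow> cos 0"
    by (rule tendsto_cos)
  then show ?thesis by (simp add: fejer_cos_def)
qed

lemma fejer_sum_strict_mono: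
  assumes "j \<ge> 2" "0 \<le> s" "s < t"
  shows "fejer_sum j s < fejer_sum j t"
  unfolding fejer_sum_def
proof (rule sum_strict_mono)
  fix k assume k: "k \<in> {1..j - 1}"
  then have "0 < fejer_cos j k" using fejer_cos_ge_half[OF k] by simp
  then show "s ^ k * fejer_cos j k < t ^ k * fejer_cos j k"
    using k assms by (intro mult_strict_right_mono power_strict_mono) auto
qed (use assms in auto)

lemma fejer_sum_mono_index:
  assumes "2 \<le> i" "i < j" "0 < t"
  shows "fejer_sum i t < fejer_sum j t"
proof -
  have "fejer_sum i t \<le> (\<Sum>k=1..i - 1. t ^ k * fejer_cos j k)"
    unfolding fejer_sum_def using assms by (intro sum_mono mult_left_mono fejer_cos_mono) auto
  also have "\<dots> < fejer_sum j t"
    unfolding fejer_sum_def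
  proof (rule sum_strict_mono2)
    \<comment> \<open>The exponent \<open>i\<close> is new in the longer sum and gives strictness
      even when no cosine grows.\<close>
    show "i \<in> {1..j - 1} - {1..i - 1}" using assms by auto
    have "1/2 \<le> fejer_cos j i" using assms by (intro fejer_cos_ge_half) auto
    then show "0 < t ^ i * fejer_cos j i" using assms by simp
    fix k assume "k \<in> {1..j - 1}"
    then show "0 \<le> t ^ k * fejer_cos j k" using fejer_cos_ge_half[of k j] assms by simp
  qed (use assms in auto)
  finally show ?thesis .
qed

text \<open>The cutoff \<open>K\<close> is free because \<open>K = 1\<close> yields a bound linear
  in \<open>t\<close>, while \<open>K = j - 1\<close> counts all terms at
  \<open>t = 1\<close>.\<close>

lemma fejer_sum_ge:
  assumes "0 \<le> t" "K \<le> j - 1"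
  shows "(\<Sum>k=1..K. t ^ k) / 2 \<le> fejer_sum j t"
proof -
  have "(\<Sum>k=1..K. t ^ k) / 2 = (\<Sum>k=1..K. t ^ k * (1 / 2))"
    by (simp add: sum_divide_distrib)
  also have "\<dots> \<le> (\<Sum>k=1..K. t ^ k * fejer_cos j k)"
    using assms by (intro sum_mono mult_left_mono fejer_cos_ge_half) auto
  also have "\<dots> \<le> fejer_sum j t"
    unfolding fejer_sum_def
  proof (rule sum_mono2)
    fix k assume "k \<in> {1..j - 1} - {1..K}"
    then have "1 / 2 \<le> fejer_cos j k" by (intro fejer_cos_ge_half) auto
    then show "0 \<le> t ^ k * fejer_cos j k" using assms by simp
  qed (use assms in auto)
  finally show ?thesis .
qed

lemma fejer_sum_solution:
  assumes "j \<ge> 2" "0 < c"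
  shows "\<exists>!t. 0 < t \<and> fejer_sum j t = c"
proof -
  \<comment> \<open>The endpoint \<open>2 * c\<close> is large enough because the linear term alone
    contributes at least \<open>t / 2\<close>.\<close>
  have "\<exists>t\<ge>0. t \<le> 2 * c \<and> fejer_sum j t = c"
  proof (rule IVT)
    have "(\<Sum>k=1..j - 1. 0 ^ k * fejer_cos j k) = 0" by (intro sum.neutral) auto
    then show "fejer_sum j 0 \<le> c" using assms by (simp add: fejer_sum_def)
    show "c \<le> fejer_sum j (2 * c)"
      using fejer_sum_ge[of "2 * c" 1 j] assms by simp
    show "\<forall>x. 0 \<le> x \<and> x \<le> 2 * c \<longrightarrow> isCont (fejer_sum j) x"
      unfolding fejer_sum_def[abs_def] by (intro allI impI continuous_intros)
  qed (use assms in auto)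
  then obtain t where t: "0 \<le> t" "fejer_sum j t = c" by blast
  have "t \<noteq> 0"
  proof
    assume "t = 0"
    then have "fejer_sum j t = 0" unfolding fejer_sum_def by (intro sum.neutral) auto
    then show False using t assms by simp
  qed
  show ?thesis
  proof (rule ex1I)
    show "0 < t \<and> fejer_sum j t = c" using t \<open>t \<noteq> 0\<close> by simp
    fix s assume s: "0 < s \<and> fejer_sum j s = c"
    then show "s = t"
      using fejer_sum_strict_mono[OF assms(1), of s t] fejer_sum_strict_mono[OF assms(1), of t s] t
      by (metis less_eq_real_def linorder_neqE_linordered_idom order_less_irrefl)
  qed
qed

section \<open>Range, monotonicity and limit of the solutions for a common right-hand side
  \<open>c\<close>\<close>

context
  fixes u :: "nat \<Rightarrow> real" and c :: real
  assumes sol: "\<And>j. 2 \<le> j \<Longrightarrow> 0 < u j \<and> fejer_sum j (u j) = c"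
begin

lemma fejer_solution_less:
  assumes "2 \<le> j" "0 \<le> t" "c < fejer_sum j t"
  shows "u j < t"
  using fejer_sum_strict_mono[OF assms(1), of t "u j"] sol[OF assms(1)] assms
  by (metis less_asym linorder_neqE_linordered_idom less_irrefl)

text \<open>At \<open>t = 1\<close> each of the \<open>j - 1\<close> terms is at least one half. The
  condition reads \<open>j \<ge> 3\<close> for \<open>c = 1\<close> and \<open>j \<ge> 2\<close> for
  \<open>c = 1 / 2\<close>.\<close>

lemma fejer_solution_le_one:
  assumes "2 \<le> j" "2 * c \<le> real (j - 1)"
  shows "u j \<le> 1"
proof (rule ccontr)
  assume "\<not> u j \<le> 1"
  then have "fejer_sum j 1 < c"
    using fejer_sum_strict_mono[OF assms(1), of 1 "u j"] sol[OF assms(1)] by simp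
  moreover have "real (j - 1) / 2 \<le> fejer_sum j 1"
    using fejer_sum_ge[of 1 "j - 1" j] by simp
  ultimately show False using assms by simp
qed

lemma fejer_solution_antimono: "strict_antimono_on {2..} u"
proof (rule monotone_onI)
  fix i j :: nat assume ij: "i \<in> {2..}" "j \<in> {2..}" "i < j"
  then have "c < fejer_sum j (u i)"
    using fejer_sum_mono_index[of i j "u i"] sol[of i] by auto
  then show "u i > u j"
    using ij sol[of i] by (intro fejer_solution_less) auto
qed

text \<open>The limit is the point where the geometric series \<open>t / (1 - t)\<close> takes the
  value \<open>c\<close>.\<close>

lemma fejer_solution_tendsto: "u \<longlonglongrightarrow> c / (1 + c)"
proof -
  have "0 < c"
    using sol[of 2] fejer_sum_strict_mono[of 2 0 "u 2"] by (simp add: fejer_sum_def)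
  let ?l = "c / (1 + c)"
  have l: "0 < ?l" "?l < 1" using \<open>0 < c\<close> by (simp_all add: field_simps)
  have geo: "(\<lambda>K. \<Sum>k=1..K. t ^ k) \<longlonglongrightarrow> t / (1 - t)" if "0 \<le> t" "t < 1" for t :: real
  proof -
    have "(\<lambda>k. t * t ^ k) sums (t * (1 / (1 - t)))"
      using that by (intro sums_mult geometric_sums) auto
    then have "(\<lambda>n. \<Sum>k<n. t * t ^ k) \<longlonglongrightarrow> t / (1 - t)" by (simp add: sums_def)
    moreover have "(\<Sum>k<n. t * t ^ k) = (\<Sum>k=1..n. t ^ k)" for n
      by (simp add: sum.atLeast1_atMost_eq)
    ultimately show ?thesis by simp
  qed
  \<comment> \<open>Cosines are at most 1, so every sum stays below the geometric series and no
    solution can lie below its root.\<close>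
  have lower: "?l \<le> u j" if "2 \<le> j" for j
  proof (rule ccontr)
    assume "\<not> ?l \<le> u j"
    then have uj: "0 < u j" "u j < ?l" using sol[OF that] by auto
    then have "fejer_sum j (u j) < fejer_sum j ?l" by (intro fejer_sum_strict_mono that) auto
    also have "\<dots> \<le> (\<Sum>k=1..j - 1. ?l ^ k)"
      unfolding fejer_sum_def using l fejer_cos_le_one
      by (intro sum_mono mult_left_le) auto
    also have "\<dots> \<le> ?l / (1 - ?l)"
    proof (rule incseq_le[OF _ geo])
      show "incseq (\<lambda>K. \<Sum>k=1..K. ?l ^ k)"
        using l by (intro monoI sum_mono2) auto
    qed (use l in auto)
    also have "\<dots> = c" using \<open>0 < c\<close> by (simp add: field_simps)
    finally show False using sol[OF that] by simp
  qed
  \<comment> \<open>Beyond the root a finite partial sum already exceeds \<open>c\<close>. With its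
    length \<open>K\<close> fixed, all \<open>K\<close> cosines may tend to 1 together.\<close>
  have upper: "\<forall>\<^sub>F j in sequentially. u j < t" if t: "?l < t" "t < 1" for t
  proof -
    have t0: "0 < t" using t l by simp
    have "c < t / (1 - t)" using t \<open>0 < c\<close> by (simp add: field_simps)
    then have "\<forall>\<^sub>F K in sequentially. c < (\<Sum>k=1..K. t ^ k)"
      using geo[of t] t t0 by (intro order_tendstoD(1)) auto
    then obtain K where K: "c < (\<Sum>k=1..K. t ^ k)"
      by (metis eventually_sequentially order_refl)
    have "(\<lambda>j. \<Sum>k=1..K. t ^ k * fejer_cos j k) \<longlonglongrightarrow> (\<Sum>k=1..K. t ^ k * 1)"
      by (intro tendsto_sum tendsto_mult tendsto_const fejer_cos_tendsto) auto
    then have "\<forall>\<^sub>F j in sequentially. c < (\<Sum>k=1..K. t ^ k * fejer_cos j k)"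
      using K by (intro order_tendstoD(1)) auto
    then show ?thesis
      using eventually_ge_at_top[of "K + 2"]
    proof eventually_elim
      case (elim j)
      have "(\<Sum>k=1..K. t ^ k * fejer_cos j k) \<le> fejer_sum j t"
        unfolding fejer_sum_def
      proof (rule sum_mono2)
        fix k assume "k \<in> {1..j - 1} - {1..K}"
        then have "1 / 2 \<le> fejer_cos j k" by (intro fejer_cos_ge_half) auto
        then show "0 \<le> t ^ k * fejer_cos j k" using t0 by simp
      qed (use elim in auto)
      then show ?case using elim t0 by (intro fejer_solution_less) auto
    qed
  qed
  show ?thesis
  proof (rule order_tendstoI)
    fix y assume "y < ?l"
    then show "\<forall>\<^sub>F j in sequentially. y < u j"
      using lower by (intro eventually_sequentiallyI[of 2]) (rule less_le_trans)
  next
    fix y assume y: "?l < y"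
    obtain t where "?l < t" "t < min y 1"
      using dense[of ?l "min y 1"] y l by auto
    then show "\<forall>\<^sub>F j in sequentially. u j < y"
      using upper[of t] by (auto elim: eventually_mono)
  qed
qed

end

section \<open>Adjoints and row contractions\<close>

text \<open>Needed for the existence of adjoints, without which the description in
  \<open>adj\<close> says nothing. The real inner product suffices.\<close>

lemma riesz_representation:
  fixes \<phi> :: "'a::{real_inner, complete_space} \<Rightarrow> real"
  assumes "bounded_linear \<phi>"
  shows "\<exists>z. \<forall>x. \<phi> x = inner x z"
proof -
  interpret bounded_linear \<phi> by fact
  \<comment> \<open>The representing vector is the minimizer of this quadratic functional.\<close>
  define J where "J x = (norm x)\<^sup>2 - 2 * \<phi> x" for x
  obtain K where K: "\<And>x. norm (\<phi> x) \<le> norm x * K" using bounded by blast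
  have "- K\<^sup>2 \<le> J x" for x
  proof -
    have "\<phi> x \<le> norm x * K" using K[of x] by simp
    moreover have "0 \<le> (norm x - K)\<^sup>2" by simp
    ultimately show ?thesis unfolding J_def by (simp add: power2_diff)
  qed
  then have bdd: "bdd_below (range J)" by (rule bdd_belowI2)
  define I where "I = Inf (range J)"
  have I: "I \<le> J x" for x unfolding I_def using bdd by (intro cInf_lower) auto
  have "\<exists>x. J x < I + 1 / real (Suc n)" for n
    using cInf_lessD[of "range J" "I + 1 / real (Suc n)"] unfolding I_def by auto
  then obtain X where X: "\<And>n. J (X n) < I + 1 / real (Suc n)" by metis
  \<comment> \<open>This is the parallelogram law: the linear parts of \<open>J\<close> cancel
    against those at the midpoint, so near-minimizers are close to each other.\<close>
  have par: "(norm (x - y))\<^sup>2 = 2 * (J x + J y - 2 * J ((1/2) *\<^sub>R (x + y)))" for x y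
    unfolding J_def power2_norm_eq_inner
    by (simp add: add scale inner_add inner_diff inner_commute algebra_simps)
  have "Cauchy X"
  proof (rule metric_CauchyI)
    fix e :: real assume "0 < e"
    \<comment> \<open>Two values of \<open>J\<close> within \<open>e\<^sup>2 / 4\<close> of the
      infimum force distance below \<open>e\<close> by \<open>par\<close>, the value at the midpoint
      being at least \<open>I\<close>.\<close>
    then obtain M where M: "4 / e\<^sup>2 < real (Suc M)"
      using reals_Archimedean2 by (metis Suc_n_not_le_n less_le_trans of_nat_le_iff nat_le_linear)
    have near: "J (X n) < I + e\<^sup>2 / 4" if "n \<ge> M" for n
    proof -
      have "4 / e\<^sup>2 < real (Suc n)" using M that by simp
      then have "1 / real (Suc n) < e\<^sup>2 / 4" using \<open>0 < e\<close> by (simp add: field_simps)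
      then show ?thesis using X[of n] by linarith
    qed
    have "dist (X m) (X n) < e" if "m \<ge> M" "n \<ge> M" for m n
    proof -
      have "(norm (X m - X n))\<^sup>2 < e\<^sup>2"
        using par[of "X m" "X n"] I[of "(1/2) *\<^sub>R (X m + X n)"] near[OF that(1)] near[OF that(2)]
        by argo
      then show ?thesis using \<open>0 < e\<close> by (simp add: dist_norm power2_less_imp_less)
    qed
    then show "\<exists>M. \<forall>m\<ge>M. \<forall>n\<ge>M. dist (X m) (X n) < e" by blast
  qed
  then obtain z where z: "X \<longlonglongrightarrow> z" using Cauchy_convergent convergent_def by blast
  have "J z \<le> I"
  proof (rule LIMSEQ_le)
    show "(\<lambda>n. J (X n)) \<longlonglongrightarrow> J z"
      unfolding J_def by (intro tendsto_intros tendsto z)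
    show "(\<lambda>n. I + 1 / real (Suc n)) \<longlonglongrightarrow> I"
      using LIMSEQ_inverse_real_of_nat_add[of I] by (simp add: inverse_eq_divide)
    show "\<exists>N. \<forall>n\<ge>N. J (X n) \<le> I + 1 / real (Suc n)" using X less_imp_le by blast
  qed
  have "\<phi> x = inner x z" for x
  proof (rule ccontr)
    assume neq: "\<phi> x \<noteq> inner x z"
    define d where "d = inner x z - \<phi> x"
    \<comment> \<open>Moving from \<open>z\<close> along \<open>- d\<close> times \<open>x\<close>
      lowers \<open>J\<close> to first order; this step size keeps the quadratic term below the
      linear gain, contradicting minimality.\<close>
    define s where "s = 1 / ((norm x)\<^sup>2 + 1)"
    have s: "0 < s" "s * (norm x)\<^sup>2 < 1"
      unfolding s_def by (auto simp: add_pos_nonneg add_nonneg_pos divide_less_eq)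
    have "J (z + (- (s * d)) *\<^sub>R x) = J z - 2 * (s * d) * d + (s * d)\<^sup>2 * (norm x)\<^sup>2"
      unfolding J_def power2_norm_eq_inner d_def
      by (simp add: add diff scale inner_add inner_diff inner_commute power2_eq_square algebra_simps)
    then have "0 \<le> - 2 * (s * d) * d + (s * d)\<^sup>2 * (norm x)\<^sup>2"
      using \<open>J z \<le> I\<close> I[of "z + (- (s * d)) *\<^sub>R x"] by simp
    also have "\<dots> = s * d\<^sup>2 * (s * (norm x)\<^sup>2 - 2)" by (simp add: power2_eq_square algebra_simps)
    finally have "0 \<le> s * d\<^sup>2 * (s * (norm x)\<^sup>2 - 2)" .
    moreover have "0 < s * d\<^sup>2" using s neq by (simp add: d_def)
    ultimately show False using s by (simp add: zero_le_mult_iff)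
  qed
  then show ?thesis by blast
qed

lemma cinner_zero_left [simp]: "cinner 0 (x :: 'a::complex_inner) = 0"
  using cinner_add_left[of 0 0 x] by simp

lemma cinner_zero_right [simp]: "cinner (x :: 'a::complex_inner) 0 = 0"
  using cinner_add_right[of x 0 0] by simp

lemma cinner_sum_left: "cinner (\<Sum>i\<in>I. f i) (x :: 'a::complex_inner) = (\<Sum>i\<in>I. cinner (f i) x)"
  by (induction I rule: infinite_finite_induct) (simp_all add: cinner_add_left)

lemma cinner_sum_right: "cinner (x :: 'a::complex_inner) (\<Sum>i\<in>I. f i) = (\<Sum>i\<in>I. cinner x (f i))"
  by (induction I rule: infinite_finite_induct) (simp_all add: cinner_add_right)

lemma cinner_scaleR_left: "cinner (r *\<^sub>R x) (y :: 'a::complex_inner) = of_real r * cinner x y"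
  by (metis cinner_scaleC_left scaleC_of_real)

lemma cinner_scaleR_right: "cinner x (r *\<^sub>R (y :: 'a::complex_inner)) = of_real r * cinner x y"
  by (metis cinner_scaleC_right scaleC_of_real complex_cnj_complex_of_real)

lemma cinner_self: "cinner x (x :: 'a::complex_inner) = of_real ((norm x)\<^sup>2)"
proof (rule complex_eqI)
  show "Im (cinner x x) = Im (of_real ((norm x)\<^sup>2))"
    using arg_cong[OF cinner_commute[of x x], of Im] by simp
qed (simp add: Re_cinner power2_norm_eq_inner)

lemma bop_apply_scaleC: "bop_apply A (c *\<^sub>C x) = c *\<^sub>C bop_apply A x"
  using bop_apply[of A] by (simp add: bounded_clinear_def)

lemma bop_apply_sum: "bop_apply (\<Sum>i\<in>I. F i) x = (\<Sum>i\<in>I. bop_apply (F i) x)"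
  by (induction I rule: infinite_finite_induct) (simp_all add: zero_bop.rep_eq plus_bop.rep_eq)

lemma bop_apply_sum_vec: "bop_apply A (\<Sum>i\<in>I. f i) = (\<Sum>i\<in>I. bop_apply A (f i))"
  by (rule linear_sum[OF bounded_linear.linear[OF bounded_linear_bop_apply]])

lemma norm_bop_apply: "norm (bop_apply A x) \<le> norm A * norm x"
  by (simp add: norm_bop.rep_eq onorm bounded_linear_bop_apply)

lemma norm_bop_leI:
  assumes "0 \<le> b" "\<And>x. norm (bop_apply A x) \<le> b * norm x"
  shows "norm A \<le> b"
  unfolding norm_bop.rep_eq using assms by (rule onorm_bound)

lemma norm_one_bop_le: "norm (1 :: 'a::complex_inner bop) \<le> 1"
  by (rule norm_bop_leI) (simp_all add: one_bop.rep_eq)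

lemma adj_exists: "\<exists>B. \<forall>x y. cinner (bop_apply (A :: 'a::chilbert_space bop) x) y = cinner x (bop_apply B y)"
proof -
  have "\<exists>z. \<forall>x. inner (bop_apply A x) y = inner x z" for y
    by (rule riesz_representation)
      (intro bounded_linear_inner_left_comp bounded_linear_bop_apply)
  then obtain g where g: "\<And>x y. inner (bop_apply A x) y = inner x (g y)" by metis
  \<comment> \<open>Evaluating the real identity at \<open>\<i> *\<^sub>C x\<close> recovers the
    imaginary part.\<close>
  have cg: "cinner (bop_apply A x) y = cinner x (g y)" for x y
  proof (rule complex_eqI)
    have Im: "Im (cinner u v) = - inner (\<i> *\<^sub>C u) v" for u v :: 'a
      by (simp add: Re_cinner[symmetric] cinner_scaleC_left)
    show "Im (cinner (bop_apply A x) y) = Im (cinner x (g y))"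
      by (simp add: Im bop_apply_scaleC[symmetric] g)
  qed (simp add: Re_cinner g)
  have add: "g (x + y) = g x + g y" for x y
    by (rule cinner_eqI) (simp add: cg[symmetric] cinner_add_right)
  have scale: "g (c *\<^sub>C x) = c *\<^sub>C g x" for c x
    by (rule cinner_eqI) (simp add: cg[symmetric] cinner_scaleC_right)
  have bound: "norm (g y) \<le> norm y * norm A" for y
  proof (cases "g y = 0")
    case False
    have "norm (g y) * norm (g y) = inner (bop_apply A (g y)) y"
      by (simp add: g power2_norm_eq_inner[symmetric] power2_eq_square)
    also have "\<dots> \<le> norm (bop_apply A (g y)) * norm y" by (rule norm_cauchy_schwarz)
    also have "\<dots> \<le> norm A * norm (g y) * norm y" by (intro mult_right_mono norm_bop_apply) simp
    finally have "norm (g y) * norm (g y) \<le> (norm y * norm A) * norm (g y)" by (simp add: mult_ac)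
    then show ?thesis using False by simp
  qed simp
  have "bounded_clinear g"
    unfolding bounded_clinear_def
    by (auto simp: add scale bound scaleC_of_real[symmetric] intro!: bounded_linear_intro[of _ "norm A"])
  then have "bop_apply (Bop g) = g" by (simp add: Bop_inverse)
  then show ?thesis using cg by metis
qed

lemma cinner_adj: "cinner (bop_apply A x) y = cinner x (bop_apply (adj A) y)"
  using adj_exists[of A] adj_eqI by metis

lemma cinner_adj': "cinner (bop_apply (adj A) x) y = cinner x (bop_apply A y)"
  by (metis cinner_adj cinner_commute)

lemma adj_adj: "adj (adj A) = A"
  by (rule adj_eqI) (rule cinner_adj')

lemma adj_add: "adj (A + B) = adj A + adj B"
  by (rule adj_eqI) (simp add: plus_bop.rep_eq cinner_add_left cinner_add_right cinner_adj)

lemma adj_zero: "adj 0 = 0"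
  by (rule adj_eqI) (simp add: zero_bop.rep_eq)

lemma adj_one: "adj 1 = 1"
  by (rule adj_eqI) (simp add: one_bop.rep_eq)

lemma adj_scaleR: "adj (r *\<^sub>R A) = r *\<^sub>R adj A"
  by (rule adj_eqI) (simp add: scaleR_bop.rep_eq cinner_scaleR_left cinner_scaleR_right cinner_adj)

lemma adj_mult: "adj (A * B) = adj B * adj A"
  by (rule adj_eqI) (simp add: times_bop.rep_eq cinner_adj)

lemma adj_sum: "adj (\<Sum>i\<in>I. F i) = (\<Sum>i\<in>I. adj (F i))"
  by (induction I rule: infinite_finite_induct) (simp_all add: adj_add adj_zero)

lemma norm_adj: "norm (adj A) = norm A"
proof -
  have le: "norm (adj B) \<le> norm B" for B :: "'a bop"
  proof (rule norm_bop_leI)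
    fix y
    let ?z = "bop_apply (adj B) y"
    have "norm ?z * norm ?z = Re (cinner (bop_apply B ?z) y)"
      unfolding cinner_adj[of B] by (simp add: Re_cinner power2_norm_eq_inner[symmetric] power2_eq_square)
    also have "\<dots> \<le> norm (bop_apply B ?z) * norm y"
      unfolding Re_cinner by (rule norm_cauchy_schwarz)
    also have "\<dots> \<le> norm B * norm ?z * norm y" by (intro mult_right_mono norm_bop_apply) simp
    finally have "norm ?z * norm ?z \<le> (norm B * norm y) * norm ?z" by (simp add: mult_ac)
    then show "norm ?z \<le> norm B * norm y" by (cases "?z = 0") auto
  qed simp
  show ?thesis using le[of A] le[of "adj A"] by (simp add: adj_adj)
qed

section \<open>Sums over words and row contractions\<close>

lemma sum_words_Suc:
  "(\<Sum>w | length w = Suc k. f w) = (\<Sum>i\<in>(UNIV :: 'n::finite set). \<Sum>w | length w = k. f (i # w))"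
proof -
  have "{w :: 'n list. length w = Suc k} = (\<lambda>(i, w). i # w) ` (UNIV \<times> {w. length w = k})"
    by (auto simp: length_Suc_conv image_iff)
  then show ?thesis
    by (simp add: sum.reindex inj_on_def sum.cartesian_product split_def)
qed

lemma opword_Nil [simp]: "opword T [] = 1"
  by (simp add: opword_def)

lemma opword_Cons [simp]: "opword T (i # \<alpha>) = T i * opword T \<alpha>"
  by (simp add: opword_def)

lemma opword_append: "opword T (\<alpha> @ \<beta>) = opword T \<alpha> * opword T \<beta>"
  by (simp add: opword_def)

lemma row_ball_nonneg: "T \<in> row_ball r \<Longrightarrow> 0 \<le> r"
  unfolding row_ball_def by (metis (lifting) mem_Collect_eq norm_ge_zero order_trans real_sqrt_ge_zero)

text \<open>The left side is the quadratic form of the sum of the \<open>T i * adj (T i)\<close>,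
  whose norm the row ball bounds by \<open>r\<^sup>2\<close>. A row bound thus controls the adjoints
  jointly.\<close>

lemma row_ball_sum_adj:
  assumes "T \<in> row_ball r"
  shows "(\<Sum>i\<in>UNIV. (norm (bop_apply (adj (T i)) y))\<^sup>2) \<le> r\<^sup>2 * (norm y)\<^sup>2"
proof -
  let ?R = "\<Sum>i\<in>UNIV. T i * adj (T i)"
  have R: "norm ?R \<le> r\<^sup>2"
    using assms unfolding row_ball_def by (metis (lifting) mem_Collect_eq norm_ge_zero sqrt_le_D)
  have "(norm (bop_apply (adj (T i)) y))\<^sup>2 = inner (bop_apply (T i * adj (T i)) y) y" for i
    using arg_cong[OF cinner_adj[of "T i" "bop_apply (adj (T i)) y" y], of Re]
    by (simp add: Re_cinner power2_norm_eq_inner times_bop.rep_eq)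
  then have "(\<Sum>i\<in>UNIV. (norm (bop_apply (adj (T i)) y))\<^sup>2) = inner (bop_apply ?R y) y"
    by (simp add: bop_apply_sum inner_sum_left)
  also have "\<dots> \<le> norm (bop_apply ?R y) * norm y" by (rule norm_cauchy_schwarz)
  also have "\<dots> \<le> (norm ?R * norm y) * norm y" by (intro mult_right_mono norm_bop_apply) simp
  also have "\<dots> \<le> (r\<^sup>2 * norm y) * norm y" by (intro mult_right_mono R) auto
  finally show ?thesis by (simp add: power2_eq_square mult_ac)
qed

text \<open>The adjoint reverses products, so the first letter of a word acts first on
  \<open>y\<close>; the induction hypothesis is then applied at \<open>adj (T i)\<close> of
  \<open>y\<close>, which is why \<open>y\<close> varies.\<close>

lemma row_ball_sum_adj_words:
  assumes "T \<in> row_ball r"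
  shows "(\<Sum>\<alpha> | length \<alpha> = k. (norm (bop_apply (adj (opword T \<alpha>)) y))\<^sup>2) \<le> (r ^ k)\<^sup>2 * (norm y)\<^sup>2"
proof (induction k arbitrary: y)
  case 0
  then show ?case by (simp add: adj_one one_bop.rep_eq)
next
  case (Suc k)
  have "(\<Sum>\<alpha> | length \<alpha> = Suc k. (norm (bop_apply (adj (opword T \<alpha>)) y))\<^sup>2)
      = (\<Sum>i\<in>UNIV. \<Sum>\<alpha> | length \<alpha> = k. (norm (bop_apply (adj (opword T \<alpha>)) (bop_apply (adj (T i)) y)))\<^sup>2)"
    by (simp add: sum_words_Suc adj_mult times_bop.rep_eq)
  also have "\<dots> \<le> (\<Sum>i\<in>UNIV. (r ^ k)\<^sup>2 * (norm (bop_apply (adj (T i)) y))\<^sup>2)"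
    by (intro sum_mono Suc)
  also have "\<dots> \<le> (r ^ k)\<^sup>2 * (r\<^sup>2 * (norm y)\<^sup>2)"
    unfolding sum_distrib_left[symmetric] by (intro mult_left_mono row_ball_sum_adj assms) simp
  finally show ?case by (simp add: power_mult_distrib mult_ac)
qed

lemma sum_mult_le_L2_set: "(\<Sum>i\<in>I. f i * g i) \<le> L2_set f I * L2_set g I"
proof -
  have "(\<Sum>i\<in>I. f i * g i) \<le> (\<Sum>i\<in>I. \<bar>f i\<bar> * \<bar>g i\<bar>)"
    by (intro sum_mono) (simp add: abs_mult[symmetric])
  also have "\<dots> \<le> L2_set f I * L2_set g I" by (rule L2_set_mult_ineq)
  finally show ?thesis .
qed

lemma norm_sum_opword_adj_le:
  assumes "T \<in> row_ball r"
  shows "norm (\<Sum>\<alpha> | length \<alpha> = k. c \<alpha> *\<^sub>R adj (opword T \<alpha>)) \<le> r ^ k * sqrt (\<Sum>\<alpha> | length \<alpha> = k. (c \<alpha>)\<^sup>2)"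
proof (rule norm_bop_leI)
  fix y
  let ?W = "{\<alpha> :: 'a list. length \<alpha> = k}"
  let ?n = "\<lambda>\<alpha>. norm (bop_apply (adj (opword T \<alpha>)) y)"
  have r: "0 \<le> r" using row_ball_nonneg[OF assms] .
  have "norm (bop_apply (\<Sum>\<alpha>\<in>?W. c \<alpha> *\<^sub>R adj (opword T \<alpha>)) y) \<le> (\<Sum>\<alpha>\<in>?W. \<bar>c \<alpha>\<bar> * ?n \<alpha>)"
    unfolding bop_apply_sum by (rule sum_norm_le) (simp add: scaleR_bop.rep_eq)
  also have "\<dots> \<le> L2_set (\<lambda>\<alpha>. \<bar>c \<alpha>\<bar>) ?W * L2_set ?n ?W" by (rule sum_mult_le_L2_set)
  also have "\<dots> \<le> L2_set (\<lambda>\<alpha>. \<bar>c \<alpha>\<bar>) ?W * (r ^ k * norm y)"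
  proof (intro mult_left_mono)
    show "L2_set ?n ?W \<le> r ^ k * norm y"
      unfolding L2_set_def using row_ball_sum_adj_words[OF assms, of y k] r
      by (intro real_le_lsqrt) (auto simp: power_mult_distrib sum_nonneg)
  qed simp
  finally show "norm (bop_apply (\<Sum>\<alpha>\<in>?W. c \<alpha> *\<^sub>R adj (opword T \<alpha>)) y)
      \<le> r ^ k * sqrt (\<Sum>\<alpha>\<in>?W. (c \<alpha>)\<^sup>2) * norm y"
    by (simp add: L2_set_def mult_ac)
qed (use row_ball_nonneg[OF assms] in \<open>simp add: sum_nonneg\<close>)

text \<open>The row bound sees only adjoints, so the sum is replaced by its adjoint, which has the
  same norm and the same real coefficients.\<close>

lemma norm_sum_opword_le:
  assumes "T \<in> row_ball r"
  shows "norm (\<Sum>\<alpha> | length \<alpha> = k. c \<alpha> *\<^sub>R opword T \<alpha>) \<le> r ^ k * sqrt (\<Sum>\<alpha> | length \<alpha> = k. (c \<alpha>)\<^sup>2)"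
  using norm_sum_opword_adj_le[OF assms, of c k]
  by (simp add: norm_adj[of "\<Sum>\<alpha> | length \<alpha> = k. c \<alpha> *\<^sub>R opword T \<alpha>", symmetric] adj_sum adj_scaleR)

text \<open>Expanding the \<open>k\<close>-th power of the sum of the squares of the
  \<open>r $ i\<close> produces one term for each word of length \<open>k\<close>.\<close>

lemma sum_numword_sq: "(\<Sum>\<alpha> | length \<alpha> = k. (numword r \<alpha>)\<^sup>2) = (norm r ^ k)\<^sup>2"
proof (induction k)
  case 0
  then show ?case by (simp add: numword_def)
next
  case (Suc k)
  have "numword r (i # \<alpha>) = r $ i * numword r \<alpha>" for i \<alpha> by (simp add: numword_def)
  then have "(\<Sum>\<alpha> | length \<alpha> = Suc k. (numword r \<alpha>)\<^sup>2) = (\<Sum>i\<in>UNIV. (r $ i)\<^sup>2) * (norm r ^ k)\<^sup>2"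
    by (simp add: sum_words_Suc power_mult_distrib sum_distrib_left[symmetric] sum_distrib_right Suc)
  also have "(\<Sum>i\<in>UNIV. (r $ i)\<^sup>2) = (norm r)\<^sup>2"
    by (simp add: norm_vec_def L2_set_def sum_nonneg)
  finally show ?case by (simp add: power_mult_distrib)
qed

lemma sum_numword_le:
  "(\<Sum>\<alpha> | length \<alpha> = k. c \<alpha> * numword r \<alpha>) \<le> norm r ^ k * sqrt (\<Sum>\<alpha> | length \<alpha> = k. (c \<alpha>)\<^sup>2)"
  using sum_mult_le_L2_set[of c "numword r" "{\<alpha>. length \<alpha> = k}"]
  by (simp add: L2_set_def sum_numword_sq mult.commute)

section \<open>Quadratic forms on the Fock space\<close>

lemma creation_add: "creation i (f + g) = creation i f + creation i g"
  by transfer (simp add: tensor_def algebra_simps sum.distrib)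

text \<open>Polarization of the isometry property gives the real inner product; inserting
  \<open>\<i> *\<^sub>C g\<close> gives the imaginary part.\<close>

lemma cinner_creation_same: "cinner (creation i f) (creation i g) = cinner f g"
proof -
  have inner: "inner (creation i f) (creation i g) = inner f g" for f g :: "'a fock"
    using norm_creation[of i "f + g"] norm_creation[of i f] norm_creation[of i g]
    unfolding creation_add by (simp add: norm_eq_sqrt_inner inner_add inner_commute)
  show ?thesis
    using inner[of f "\<i> *\<^sub>C g"] inner[of f g] bop_apply_scaleC[of "left_creation i" \<i> g]
    by (simp add: complex_eq_iff Re_cinner Im_cinner left_creation.rep_eq)
qed

lemma cinner_fock_eq_0:
  assumes "\<And>\<alpha>. fock_coeff f \<alpha> * cnj (fock_coeff g \<alpha>) = 0"
  shows "cinner f g = 0"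
  by (simp add: cinner_fock_def comp_cinner_def assms)

lemma cinner_creation: "cinner (creation i f) (creation j g) = (if i = j then cinner f g else 0)"
proof (cases "i = j")
  case False
  have "fock_coeff (creation i f) \<alpha> * cnj (fock_coeff (creation j g) \<alpha>) = 0" for \<alpha>
    using False by (cases \<alpha>) (simp_all add: creation.rep_eq tensor_basis_Nil tensor_basis_Cons)
  then show ?thesis using False by (simp add: cinner_fock_eq_0)
qed (simp add: cinner_creation_same)

text \<open>The creation operators are isometries with orthogonal ranges. Equal lengths matter: a
  word and a proper prefix of it can have ranges that are not orthogonal.\<close>

lemma cinner_opword_left_creation:
  assumes "length \<alpha> = length \<beta>"
  shows "cinner (bop_apply (opword left_creation \<alpha>) f) (bop_apply (opword left_creation \<beta>) g)
    = (if \<alpha> = \<beta> then cinner f g else 0)"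
  using assms
  by (induction \<alpha> \<beta> rule: list_induct2)
    (auto simp: one_bop.rep_eq times_bop.rep_eq left_creation.rep_eq cinner_creation)

section \<open>The vacuum, the grading and homogeneous operators\<close>

lift_definition vacuum :: "'n::finite fock" is "\<lambda>\<alpha>. if \<alpha> = [] then 1 else 0"
proof (rule summable_finite[of "{0}"])
  fix k :: nat assume "k \<notin> {0}"
  then show "comp_sq_norm (\<lambda>\<alpha> :: 'n list. if \<alpha> = [] then 1 else 0) k = 0"
    unfolding comp_sq_norm_def by (intro sum.neutral) auto
qed simp

lemma cinner_vacuum: "cinner vacuum (vacuum :: 'n::finite fock) = 1"
proof -
  have "comp_cinner (fock_coeff (vacuum :: 'n fock)) (fock_coeff vacuum) k = (if k = 0 then 1 else 0)" for k
    unfolding comp_cinner_def vacuum.rep_eq by (auto intro!: sum.neutral)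
  then show ?thesis
    unfolding cinner_fock_def by (subst suminf_finite[of "{0}"]) simp_all
qed

definition homogeneous :: "nat \<Rightarrow> 'n::finite fock \<Rightarrow> bool" where
  "homogeneous d f \<longleftrightarrow> (\<forall>\<alpha>. length \<alpha> \<noteq> d \<longrightarrow> fock_coeff f \<alpha> = 0)"

lemma cinner_homogeneous:
  "homogeneous d f \<Longrightarrow> homogeneous e g \<Longrightarrow> d \<noteq> e \<Longrightarrow> cinner f g = 0"
  by (rule cinner_fock_eq_0) (auto simp: homogeneous_def)

lemma homogeneous_vacuum: "homogeneous 0 vacuum"
  by (simp add: homogeneous_def vacuum.rep_eq)

lemma homogeneous_sum:
  assumes "\<And>i. i \<in> I \<Longrightarrow> homogeneous d (f i)"
  shows "homogeneous d (\<Sum>i\<in>I. f i)"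
  using assms
  by (induction I rule: infinite_finite_induct)
    (auto simp: homogeneous_def zero_fock.rep_eq plus_fock.rep_eq)

lemma homogeneous_scaleC: "homogeneous d f \<Longrightarrow> homogeneous d (c *\<^sub>C f)"
  by (simp add: homogeneous_def scaleC_fock.rep_eq)

lemma homogeneous_creation:
  assumes "homogeneous d f"
  shows "homogeneous (Suc d) (creation i f)"
  unfolding homogeneous_def
proof (intro allI impI)
  fix \<alpha> :: "'a list" assume "length \<alpha> \<noteq> Suc d"
  then show "fock_coeff (creation i f) \<alpha> = 0"
    using assms by (cases \<alpha>) (auto simp: homogeneous_def creation.rep_eq tensor_basis_Nil tensor_basis_Cons)
qed

lemma homogeneous_opword:
  "homogeneous d f \<Longrightarrow> homogeneous (length \<alpha> + d) (bop_apply (opword left_creation \<alpha>) f)"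
  by (induction \<alpha>)
    (simp_all add: one_bop.rep_eq times_bop.rep_eq left_creation.rep_eq homogeneous_creation)

text \<open>It plays two roles: with the coefficients \<open>a\<close> it is the degree
  \<open>k\<close> part of the Toeplitz polynomial, and with coefficients of unit norm it is the
  isometry V.\<close>

definition homogeneous_op :: "nat \<Rightarrow> ('n::finite list \<Rightarrow> complex) \<Rightarrow> 'n fock bop" where
  "homogeneous_op k b = (\<Sum>\<alpha> | length \<alpha> = k. b \<alpha> *\<^sub>C opword left_creation \<alpha>)"

lemma bop_apply_homogeneous_op:
  "bop_apply (homogeneous_op k b) f = (\<Sum>\<alpha> | length \<alpha> = k. b \<alpha> *\<^sub>C bop_apply (opword left_creation \<alpha>) f)"
  by (simp add: homogeneous_op_def bop_apply_sum scaleC_bop.rep_eq)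

lemma homogeneous_homogeneous_op:
  assumes "homogeneous d f"
  shows "homogeneous (k + d) (bop_apply (homogeneous_op k b) f)"
  unfolding bop_apply_homogeneous_op
proof (intro homogeneous_sum homogeneous_scaleC)
  fix \<alpha> :: "'a list" assume "\<alpha> \<in> {\<alpha>. length \<alpha> = k}"
  then show "homogeneous (k + d) (bop_apply (opword left_creation \<alpha>) f)"
    using homogeneous_opword[OF assms, of \<alpha>] by simp
qed

text \<open>In operator form: the adjoint of the word operator times
  \<open>homogeneous_op k b\<close> is the scalar \<open>b \<alpha>\<close>.\<close>

lemma cinner_opword_homogeneous_op:
  assumes "length \<alpha> = k"
  shows "cinner (bop_apply (opword left_creation \<alpha>) f) (bop_apply (homogeneous_op k b) g) = cnj (b \<alpha>) * cinner f g"
proof -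
  have "cinner (bop_apply (opword left_creation \<alpha>) f) (bop_apply (homogeneous_op k b) g)
      = (\<Sum>\<beta> | length \<beta> = k. if \<alpha> = \<beta> then cnj (b \<beta>) * cinner f g else 0)"
    unfolding bop_apply_homogeneous_op cinner_sum_right
    by (intro sum.cong refl) (use assms in \<open>simp add: cinner_scaleC_right cinner_opword_left_creation\<close>)
  also have "\<dots> = cnj (b \<alpha>) * cinner f g"
    using assms by (subst sum.delta') auto
  finally show ?thesis .
qed

lemma cinner_homogeneous_op:
  "cinner (bop_apply (homogeneous_op k b) f) (bop_apply (homogeneous_op k c) g)
    = (\<Sum>\<alpha> | length \<alpha> = k. b \<alpha> * cnj (c \<alpha>)) * cinner f g"
proof -
  have "cinner (bop_apply (homogeneous_op k b) f) (bop_apply (homogeneous_op k c) g)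
      = (\<Sum>\<alpha> | length \<alpha> = k. b \<alpha> * (cnj (c \<alpha>) * cinner f g))"
    unfolding bop_apply_homogeneous_op[of k b] cinner_sum_left cinner_scaleC_left
    by (intro sum.cong refl) (simp add: cinner_opword_homogeneous_op)
  then show ?thesis by (simp add: sum_distrib_right mult.assoc)
qed

text \<open>Cutting \<open>k\<close> letters off the word cancels one factor of the power and leaves
  a scalar. After \<open>q\<close> cuts the scalar no longer depends on the vector, so it may be
  read off at the vacuum.\<close>

lemma cinner_opword_homogeneous_op_power:
  assumes "length \<alpha> = q * k"
  shows "cinner (bop_apply (opword left_creation \<alpha>) f) (bop_apply (homogeneous_op k b ^ q) f)
    = cinner (bop_apply (opword left_creation \<alpha>) vacuum) (bop_apply (homogeneous_op k b ^ q) vacuum) * cinner f f"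
  using assms
proof (induction q arbitrary: \<alpha>)
  case 0
  then show ?case by (simp add: one_bop.rep_eq cinner_vacuum)
next
  case (Suc q)
  let ?S = "\<lambda>\<alpha>. bop_apply (opword left_creation \<alpha>)"
  have len: "length (take k \<alpha>) = k" "length (drop k \<alpha>) = q * k" using Suc.prems by auto
  have "cinner (?S \<alpha> g) (bop_apply (homogeneous_op k b ^ Suc q) g)
      = cnj (b (take k \<alpha>)) * cinner (?S (drop k \<alpha>) g) (bop_apply (homogeneous_op k b ^ q) g)" for g
  proof -
    have "?S \<alpha> g = ?S (take k \<alpha>) (?S (drop k \<alpha>) g)"
      by (metis opword_append append_take_drop_id times_bop.rep_eq)
    then show ?thesis
      by (simp add: times_bop.rep_eq cinner_opword_homogeneous_op[OF len(1)])
  qed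
  then show ?case using Suc.IH[OF len(2)] by simp
qed

lemma cinner_isometry_power:
  assumes "\<And>f g. cinner (bop_apply V f) (bop_apply V g) = cinner f g"
  shows "cinner (bop_apply (V ^ j) f) (bop_apply (V ^ j) g) = cinner f g"
  by (induction j) (simp_all add: one_bop.rep_eq times_bop.rep_eq assms)

lemma homogeneous_power:
  "homogeneous (j * k) (bop_apply (homogeneous_op k b ^ j) vacuum)"
  by (induction j)
    (simp_all add: one_bop.rep_eq times_bop.rep_eq homogeneous_vacuum homogeneous_homogeneous_op)

lemma cinner_adj_homogeneous:
  "cinner (bop_apply (\<Sum>\<alpha> | length \<alpha> = k. cnj (a \<alpha>) *\<^sub>C adj (opword left_creation \<alpha>)) x) x
    = cnj (cinner (bop_apply (homogeneous_op k a) x) x)"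
proof -
  have "cinner (bop_apply (adj B) x) x = cnj (cinner (bop_apply B x) x)" for B
    by (metis cinner_adj' cinner_commute)
  then show ?thesis
    by (simp add: bop_apply_sum scaleC_bop.rep_eq cinner_sum_left cinner_scaleC_left bop_apply_homogeneous_op)
qed

lemma cinner_toeplitz_poly:
  "cinner (bop_apply (toeplitz_poly m a) x) x
    = (\<Sum>l=1..m - 1. cnj (cinner (bop_apply (homogeneous_op l a) x) x))
      + a [] * of_real ((norm x)\<^sup>2) + (\<Sum>l=1..m - 1. cinner (bop_apply (homogeneous_op l a) x) x)"
  unfolding toeplitz_poly_def homogeneous_op_def[symmetric] plus_bop.rep_eq cinner_add_left
    bop_apply_sum[of _ "{1..m - 1}"] cinner_sum_left[of _ "{1..m - 1}"] cinner_adj_homogeneous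
    scaleC_bop.rep_eq one_bop.rep_eq cinner_scaleC_left cinner_self by (rule refl)

lemma Re_cinner_toeplitz_poly:
  "Re (cinner (bop_apply (toeplitz_poly m a) x) x)
    = Re (a []) * (norm x)\<^sup>2 + 2 * (\<Sum>l=1..m - 1. Re (cinner (bop_apply (homogeneous_op l a) x) x))"
  by (simp add: cinner_toeplitz_poly)

lemma Re_cinner_bop_le: "\<bar>Re (cinner (bop_apply A x) x)\<bar> \<le> norm A * (norm x)\<^sup>2"
proof -
  have "\<bar>Re (cinner (bop_apply A x) x)\<bar> \<le> norm (bop_apply A x) * norm x"
    unfolding Re_cinner by (rule Cauchy_Schwarz_ineq2)
  also have "\<dots> \<le> norm A * norm x * norm x" by (intro mult_right_mono norm_bop_apply) simp
  finally show ?thesis by (simp add: power2_eq_square mult.assoc)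
qed

section \<open>The Toeplitz matrix of \<open>H\<close> along the orbit of the vacuum\<close>

context
  fixes a \<beta> :: "'n::finite list \<Rightarrow> complex" and k :: nat
  assumes k: "1 \<le> k" and \<beta>: "(\<Sum>\<alpha> | length \<alpha> = k. (cmod (\<beta> \<alpha>))\<^sup>2) = 1"
begin

definition orbit :: "nat \<Rightarrow> 'n fock" where
  "orbit j = bop_apply (homogeneous_op k \<beta> ^ j) vacuum"

text \<open>These are the entries on the \<open>q\<close>-th off-diagonal of the Toeplitz matrix,
  computed at the vacuum; they become the Fourier coefficients of the limiting trigonometric
  polynomial.\<close>

definition symbol :: "nat \<Rightarrow> complex" where
  "symbol q = (\<Sum>\<alpha> | length \<alpha> = q * k. a \<alpha> * cinner (bop_apply (opword left_creation \<alpha>) vacuum) (orbit q))"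

lemma cinner_orbit: "cinner (orbit i) (orbit j) = (if i = j then 1 else 0)"
proof (cases "i = j")
  case True
  have "(\<Sum>\<alpha> | length \<alpha> = k. \<beta> \<alpha> * cnj (\<beta> \<alpha>)) = of_real (\<Sum>\<alpha> | length \<alpha> = k. (cmod (\<beta> \<alpha>))\<^sup>2)"
    by (simp add: complex_norm_square del: of_real_power)
  then show ?thesis
    using True cinner_isometry_power[of "homogeneous_op k \<beta>" j vacuum vacuum] \<beta>
    by (simp add: orbit_def cinner_homogeneous_op cinner_vacuum)
next
  case False
  then show ?thesis
    using k homogeneous_power[of i k \<beta>] homogeneous_power[of j k \<beta>]
    by (simp add: orbit_def cinner_homogeneous)
qed

lemma symbol_one: "symbol 1 = (\<Sum>\<alpha> | length \<alpha> = k. a \<alpha> * cnj (\<beta> \<alpha>))"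
  unfolding symbol_def orbit_def
  by (auto simp: cinner_opword_homogeneous_op cinner_vacuum intro!: sum.cong)

text \<open>Comparing degrees leaves only \<open>l = (j - i) * k\<close>, and the entry depends on
  \<open>j - i\<close> alone because the scalar arising from a word is the same for every vector of
  unit length.\<close>

lemma cinner_homogeneous_op_orbit:
  "cinner (bop_apply (homogeneous_op l a) (orbit i)) (orbit j)
    = (if l + i * k = j * k then symbol (j - i) else 0)"
proof (cases "l + i * k = j * k")
  case True
  then have "i * k \<le> j * k" by linarith
  then have "i \<le> j" using k by simp
  then obtain q where q: "j = i + q" using le_Suc_ex by blast
  then have l: "l = q * k" using True by (simp add: add_mult_distrib)
  have "orbit j = bop_apply (homogeneous_op k \<beta> ^ q) (orbit i)"
    unfolding orbit_def q by (simp add: add.commute[of i] power_add times_bop.rep_eq)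
  then show ?thesis
    using True cinner_orbit[of i i]
    by (auto simp: bop_apply_homogeneous_op cinner_sum_left cinner_scaleC_left symbol_def q l
        cinner_opword_homogeneous_op_power[of _ q k "orbit i"] orbit_def[of q] intro!: sum.cong)
next
  case False
  then show ?thesis
    using cinner_homogeneous[OF homogeneous_homogeneous_op[OF homogeneous_power] homogeneous_power]
    by (simp add: orbit_def)
qed

text \<open>The integer part originates here: an off-diagonal \<open>q\<close> is reached exactly
  when \<open>q * k\<close> does not exceed the largest degree \<open>M\<close>.\<close>

lemma sum_cinner_homogeneous_op_orbit:
  "(\<Sum>l=1..M. cinner (bop_apply (homogeneous_op l a) (orbit i)) (orbit j))
    = (if i < j \<and> j - i \<le> M div k then symbol (j - i) else 0)"
proof (cases "i < j")
  case True
  have eq: "l + i * k = j * k \<longleftrightarrow> l = (j - i) * k" for l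
    using True by (simp add: diff_mult_distrib) (metis add_diff_cancel_right' le_add_diff_inverse2 less_imp_le_nat mult_le_mono1)
  have "(j - i) * k \<in> {1..M} \<longleftrightarrow> j - i \<le> M div k"
    using True k by (simp add: less_eq_div_iff_mult_less_eq Suc_le_eq)
  then show ?thesis
    using True by (simp add: cinner_homogeneous_op_orbit eq sum.delta del: atLeastAtMost_iff)
next
  case False
  have "l + i * k \<noteq> j * k" if "l \<in> {1..M}" for l
  proof -
    have "j * k \<le> i * k" using False by (intro mult_le_mono1) simp
    moreover have "1 \<le> l" using that by simp
    ultimately show ?thesis by linarith
  qed
  then show ?thesis using False by (simp add: cinner_homogeneous_op_orbit)
qed

text \<open>The phases of the wave depend on \<open>i\<close> and \<open>j\<close> only through
  \<open>j - i\<close> as well, and exactly \<open>L - q\<close> pairs of indices below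
  \<open>L\<close> have gap \<open>q\<close>.\<close>

lemma sum_cinner_homogeneous_op_wave:
  fixes \<theta> :: real
  defines "x L \<equiv> \<Sum>i<L. cis (- (real i * \<theta>)) *\<^sub>C orbit i"
  assumes L: "M div k \<le> L"
  shows "(\<Sum>l=1..M. cinner (bop_apply (homogeneous_op l a) (x L)) (x L))
    = (\<Sum>q=1..M div k. of_nat (L - q) * (symbol q * cis (real q * \<theta>)))"
proof -
  let ?N = "M div k"
  have "(\<Sum>l=1..M. cinner (bop_apply (homogeneous_op l a) (x L)) (x L))
    = (\<Sum>i<L. \<Sum>j<L. cis (- (real i * \<theta>)) * cis (real j * \<theta>) *
        (\<Sum>l=1..M. cinner (bop_apply (homogeneous_op l a) (orbit i)) (orbit j)))"
  proof -
    have "cinner (bop_apply (homogeneous_op l a) (x L)) (x L)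
      = (\<Sum>i<L. \<Sum>j<L. cis (- (real i * \<theta>)) * cis (real j * \<theta>) *
          cinner (bop_apply (homogeneous_op l a) (orbit i)) (orbit j))" for l
      unfolding x_def bop_apply_sum_vec bop_apply_scaleC cinner_sum_left
        cinner_scaleC_left cinner_sum_right cinner_scaleC_right sum_distrib_left
      by (subst sum.swap) (simp add: cis_cnj mult_ac)
    then show ?thesis
      unfolding sum_distrib_left
      by (simp only:) (rule trans[OF sum.swap sum.cong[OF refl sum.swap]])
  qed
  also have "\<dots> = (\<Sum>i<L. \<Sum>j<L. if i < j \<and> j - i \<le> ?N then symbol (j - i) * cis (real (j - i) * \<theta>) else 0)"
    unfolding sum_cinner_homogeneous_op_orbit
    by (intro sum.cong refl) (auto simp: cis_mult of_nat_diff algebra_simps)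
  also have "\<dots> = (\<Sum>i<L. \<Sum>q=1..?N. if i < L - q then symbol q * cis (real q * \<theta>) else 0)"
  proof (rule sum.cong[OF refl])
    fix i
    have "(\<Sum>j<L. if i < j \<and> j - i \<le> ?N then symbol (j - i) * cis (real (j - i) * \<theta>) else 0)
      = (\<Sum>j \<in> {j. j < L \<and> i < j \<and> j - i \<le> ?N}. symbol (j - i) * cis (real (j - i) * \<theta>))"
      by (intro sum.mono_neutral_cong_right) auto
    also have "\<dots> = (\<Sum>q \<in> {q \<in> {1..?N}. i < L - q}. symbol q * cis (real q * \<theta>))"
      by (rule sum.reindex_bij_witness[of _ "\<lambda>q. q + i" "\<lambda>j. j - i"]) auto
    also have "\<dots> = (\<Sum>q=1..?N. if i < L - q then symbol q * cis (real q * \<theta>) else 0)"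
      by (intro sum.mono_neutral_cong_left) auto
    finally show "(\<Sum>j<L. if i < j \<and> j - i \<le> ?N then symbol (j - i) * cis (real (j - i) * \<theta>) else 0) = \<dots>" .
  qed
  also have "\<dots> = (\<Sum>q=1..?N. of_nat (L - q) * (symbol q * cis (real q * \<theta>)))"
  proof (subst sum.swap, intro sum.cong refl)
    fix q
    have "(\<Sum>i<L. if i < L - q then symbol q * cis (real q * \<theta>) else 0) = (\<Sum>i<L - q. symbol q * cis (real q * \<theta>))"
      by (intro sum.mono_neutral_cong_right) auto
    then show "(\<Sum>i<L. if i < L - q then symbol q * cis (real q * \<theta>) else 0) = of_nat (L - q) * (symbol q * cis (real q * \<theta>))"
      by simp
  qed
  finally show ?thesis .
qed

lemma norm_wave_sq: "(norm (\<Sum>i<L. cis (- (real i * \<theta>)) *\<^sub>C orbit i))\<^sup>2 = real L"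
proof -
  let ?x = "\<Sum>i<L. cis (- (real i * \<theta>)) *\<^sub>C orbit i"
  have "cinner ?x ?x = of_nat L"
    by (simp add: cinner_sum_left cinner_sum_right cinner_scaleC_left cinner_scaleC_right cinner_orbit
        cis_cnj cis_mult if_distrib[of "\<lambda>z. _ * z"] sum.delta cong: if_cong)
  then show ?thesis unfolding cinner_self by (metis of_real_eq_iff of_real_of_nat_eq)
qed

text \<open>The waves have squared norm \<open>L\<close>, so normalization produces the Fejer
  weights \<open>1 - q / L\<close>. The number of frequencies is fixed, so the limit may be taken
  termwise.\<close>

lemma toeplitz_poly_symbol_bound:
  assumes "norm (toeplitz_poly m a) \<le> 1"
  shows "\<bar>Re (a []) + 2 * Re (\<Sum>q=1..(m - 1) div k. symbol q * cis (real q * \<theta>))\<bar> \<le> 1"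
proof -
  let ?N = "(m - 1) div k"
  let ?s = "\<lambda>q. Re (symbol q * cis (real q * \<theta>))"
  define f where "f L = \<bar>Re (a []) + 2 * (\<Sum>q=1..?N. (1 - real q / real L) * ?s q)\<bar>" for L :: nat
  have factor: "r * c + 2 * (c * s) = c * (r + 2 * s)" for r c s :: real
    by (simp add: algebra_simps)
  \<comment> \<open>Taking \<open>L\<close> above \<open>?N\<close> makes \<open>L\<close> positive
    and keeps the natural subtraction \<open>L - q\<close> exact.\<close>
  have f1: "f L \<le> 1" if L: "L \<ge> Suc ?N" for L
  proof -
    let ?x = "\<Sum>i<L. cis (- (real i * \<theta>)) *\<^sub>C orbit i"
    have "Re (cinner (bop_apply (toeplitz_poly m a) ?x) ?x)
        = Re (a []) * L + 2 * Re (\<Sum>q=1..?N. of_nat (L - q) * (symbol q * cis (real q * \<theta>)))"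
      unfolding Re_cinner_toeplitz_poly Re_sum[of _ "{1..m - 1}", symmetric] norm_wave_sq
      using L by (subst sum_cinner_homogeneous_op_wave) auto
    also have "Re (\<Sum>q=1..?N. of_nat (L - q) * (symbol q * cis (real q * \<theta>)))
        = (\<Sum>q=1..?N. real L * ((1 - real q / real L) * ?s q))"
      unfolding Re_sum
    proof (intro sum.cong refl)
      fix q assume "q \<in> {1..?N}"
      then have "real (L - q) = real L * (1 - real q / real L)"
        using L by (simp add: of_nat_diff field_simps)
      then have e: "(of_nat (L - q) :: complex) = of_real (real L * (1 - real q / real L))"
        by (metis of_real_of_nat_eq)
      have "Re (of_real c * z) = c * Re z" for c z by simp
      then show "Re (of_nat (L - q) * (symbol q * cis (real q * \<theta>))) = real L * ((1 - real q / real L) * ?s q)"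
        unfolding e by (simp only: mult.assoc)
    qed
    also have "Re (a []) * real L + 2 * (\<Sum>q=1..?N. real L * ((1 - real q / real L) * ?s q))
        = real L * (Re (a []) + 2 * (\<Sum>q=1..?N. (1 - real q / real L) * ?s q))"
      unfolding sum_distrib_left[symmetric] by (rule factor)
    finally have "Re (cinner (bop_apply (toeplitz_poly m a) ?x) ?x)
        = real L * (Re (a []) + 2 * (\<Sum>q=1..?N. (1 - real q / real L) * ?s q))" .
    then have "real L * f L = \<bar>Re (cinner (bop_apply (toeplitz_poly m a) ?x) ?x)\<bar>"
      unfolding f_def by (simp add: abs_mult del: Re_sum)
    also have "\<dots> \<le> norm (toeplitz_poly m a) * real L"
      using Re_cinner_bop_le[of "toeplitz_poly m a" ?x] unfolding norm_wave_sq .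
    also have "\<dots> \<le> 1 * real L" by (intro mult_right_mono assms) simp
    finally show ?thesis using L by simp
  qed
  have "f \<longlonglongrightarrow> \<bar>Re (a []) + 2 * (\<Sum>q=1..?N. (1 - 0) * ?s q)\<bar>"
    unfolding f_def by (intro tendsto_intros lim_const_over_n)
  then have "\<bar>Re (a []) + 2 * (\<Sum>q=1..?N. (1 - 0) * ?s q)\<bar> \<le> 1"
    by (rule LIMSEQ_le_const2) (use f1 in blast)
  then show ?thesis by simp
qed

end

section \<open>The coefficient estimate and the resulting inequalities\<close>

lemma norm_vacuum: "norm (vacuum :: 'n::finite fock) = 1"
proof -
  have "complex_of_real ((norm (vacuum :: 'n fock))\<^sup>2) = of_real 1"
    using cinner_self[of "vacuum :: 'n fock"] by (simp only: cinner_vacuum of_real_1)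
  then have "(norm (vacuum :: 'n fock))\<^sup>2 = 1" by (simp only: of_real_eq_iff)
  then show ?thesis using power2_eq_1_iff[of "norm (vacuum :: 'n fock)"] norm_ge_zero[of "vacuum :: 'n fock"] by linarith
qed

lemma toeplitz_poly_Re_const:
  assumes "norm (toeplitz_poly m a) \<le> 1"
  shows "\<bar>Re (a [])\<bar> \<le> 1"
proof -
  have "cinner (bop_apply (homogeneous_op l a) vacuum) vacuum = 0" if "l \<in> {1..m - 1}" for l
    using that
    by (intro cinner_homogeneous[OF homogeneous_homogeneous_op[OF homogeneous_vacuum] homogeneous_vacuum]) auto
  then have "Re (cinner (bop_apply (toeplitz_poly m a) vacuum) vacuum) = Re (a [])"
    unfolding Re_cinner_toeplitz_poly by (simp add: norm_vacuum)
  then show ?thesis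
    using Re_cinner_bop_le[of "toeplitz_poly m a" vacuum] assms by (simp add: norm_vacuum)
qed

text \<open>All nonconstant terms of the quadratic form come in conjugate pairs, so self-adjointness
  is a condition on the constant term.\<close>

lemma toeplitz_poly_Im_const:
  assumes "adj (toeplitz_poly m a) = toeplitz_poly m a"
  shows "Im (a []) = 0"
proof -
  let ?z = "cinner (bop_apply (toeplitz_poly m a) vacuum) vacuum"
  have "?z = cnj ?z" using assms by (metis cinner_adj cinner_commute)
  then have "Im ?z = 0" using Reals_cnj_iff complex_is_Real_iff by metis
  then show ?thesis unfolding cinner_toeplitz_poly by (simp add: norm_vacuum sum_negf)
qed

lemma toeplitz_poly_coeff_bound:
  assumes sa: "adj (toeplitz_poly m a) = toeplitz_poly m a"
    and norm: "norm (toeplitz_poly m a) \<le> 1"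
    and k: "1 \<le> k" "k \<le> m - 1"
  shows "sqrt (\<Sum>\<alpha> | length \<alpha> = k. (cmod (a \<alpha>))\<^sup>2) \<le> (1 - cmod (a [])) * fejer_cos m k"
proof -
  define s where "s = sqrt (\<Sum>\<alpha> | length \<alpha> = k. (cmod (a \<alpha>))\<^sup>2)"
  have s: "0 \<le> s" "(\<Sum>\<alpha> | length \<alpha> = k. (cmod (a \<alpha>))\<^sup>2) = s\<^sup>2"
    unfolding s_def by (simp_all add: sum_nonneg)
  have a0: "cmod (a []) = \<bar>Re (a [])\<bar>"
    using toeplitz_poly_Im_const[OF sa] by (simp add: cmod_def)
  have "s \<le> (1 - cmod (a [])) * fejer_cos m k"
  proof (cases "s = 0")
    \<comment> \<open>Vanishing coefficients cannot be normalized; here the bound just says that its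
      right side is nonnegative, which the vacuum expectation ensures.\<close>
    case True
    have "0 \<le> fejer_cos m k" using fejer_cos_ge_half[of k m] k by simp
    then show ?thesis using True toeplitz_poly_Re_const[OF norm] a0 by simp
  next
    case False
    define \<beta> where "\<beta> \<alpha> = a \<alpha> / of_real s" for \<alpha>
    have \<beta>: "(\<Sum>\<alpha> | length \<alpha> = k. (cmod (\<beta> \<alpha>))\<^sup>2) = 1"
      using False s by (simp add: \<beta>_def norm_divide power_divide sum_divide_distrib[symmetric])
    have "(\<Sum>\<alpha> | length \<alpha> = k. a \<alpha> * cnj (\<beta> \<alpha>)) = of_real (s\<^sup>2) / of_real s"
      unfolding \<beta>_def s(2)[symmetric]
      by (simp add: complex_norm_square sum_divide_distrib del: of_real_power)
    then have one: "symbol a \<beta> k 1 = of_real s"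
      using False unfolding symbol_one[OF k(1) \<beta>] by (simp add: power2_eq_square)
    \<comment> \<open>The sign selects which of the two bounds \<open>-1\<close> and
      \<open>1\<close> to use, so that the constant term becomes \<open>1 - cmod (a [])\<close>
      rather than \<open>1 + cmod (a [])\<close>.\<close>
    define \<sigma> :: real where "\<sigma> = (if Re (a []) \<le> 0 then 1 else - 1)"
    let ?N = "(m - 1) div k"
    have "cmod (2 * of_real \<sigma> * symbol a \<beta> k 1) \<le> 2 * (1 - cmod (a [])) * cos (pi / (real ?N + 2))"
    proof (rule nonneg_trig_poly_coeff_bound)
      show "1 \<le> ?N" using k by (simp add: div_greater_zero_iff Suc_le_eq)
      fix \<theta>
      let ?S = "\<Sum>q=1..?N. symbol a \<beta> k q * cis (real q * \<theta>)"
      have "(\<Sum>q=1..?N. 2 * of_real \<sigma> * symbol a \<beta> k q * cis (real q * \<theta>)) = of_real (2 * \<sigma>) * ?S"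
        by (simp add: sum_distrib_left mult.assoc)
      moreover have "Re (of_real (2 * \<sigma>) * ?S) = 2 * \<sigma> * Re ?S" by (simp del: Re_sum)
      ultimately show "0 \<le> 1 - cmod (a []) + Re (\<Sum>q=1..?N. 2 * of_real \<sigma> * symbol a \<beta> k q * cis (real q * \<theta>))"
        using toeplitz_poly_symbol_bound[OF k(1) \<beta> norm, of \<theta>]
        unfolding a0 \<sigma>_def by (auto simp del: Re_sum split: if_splits)
    qed
    moreover have "cmod (2 * of_real \<sigma> * symbol a \<beta> k 1) = 2 * s"
      unfolding one using s(1) by (simp add: norm_mult \<sigma>_def)
    ultimately show ?thesis
      unfolding fejer_cos_def mult.assoc by linarith
  qed
  then show ?thesis unfolding s_def .
qed

text \<open>Common to all four inequalities: the summand bounds by powers of \<open>t\<close>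
  combine with the coefficient estimate, and at a radius the resulting \<open>fejer_sum\<close> is 1
  or one half.\<close>

lemma sum_fejer_weight_le:
  assumes "\<And>k. k \<in> {1..m - 1} \<Longrightarrow> g k \<le> t ^ k * sqrt (\<Sum>\<alpha> | length \<alpha> = k. (cmod (a \<alpha>))\<^sup>2)"
    and "\<And>k. k \<in> {1..m - 1} \<Longrightarrow> sqrt (\<Sum>\<alpha> | length \<alpha> = k. (cmod (a \<alpha>))\<^sup>2) \<le> (1 - cmod (a [])) * fejer_cos m k"
    and "0 \<le> t"
  shows "(\<Sum>k=1..m - 1. g k) \<le> (1 - cmod (a [])) * fejer_sum m t"
  unfolding fejer_sum_def sum_distrib_left
proof (rule sum_mono)
  fix k assume k: "k \<in> {1..m - 1}"
  have "g k \<le> t ^ k * ((1 - cmod (a [])) * fejer_cos m k)"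
    using assms(1)[OF k] mult_left_mono[OF assms(2)[OF k], of "t ^ k"] assms(3) by simp
  then show "g k \<le> (1 - cmod (a [])) * (t ^ k * fejer_cos m k)" by (simp add: mult_ac)
qed

theorem theorem1p8:
  fixes m :: nat and a :: "'n::finite list \<Rightarrow> complex"
  assumes "m \<ge> 2"
    and "toeplitz_poly m a \<in> cstar_generated (range left_creation)"
    and "adj (toeplitz_poly m a) = toeplitz_poly m a"
    and "norm (toeplitz_poly m a) \<le> 1"
  shows
    \<comment> \<open>(i)\<close>
    "(\<forall>k. 1 \<le> k \<and> k \<le> m - 1 \<longrightarrow>
        sqrt (\<Sum>\<alpha> | length \<alpha> = k. (cmod (a \<alpha>))\<^sup>2)
          \<le> (1 - cmod (a [])) * cos (pi / (real ((m - 1) div k) + 2)))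
    \<comment> \<open>(ii)\<close>
   \<and> (\<forall>T :: 'n \<Rightarrow> 'h::chilbert_space bop. T \<in> row_ball (bohr_gamma m) \<longrightarrow>
        (\<Sum>k=0..m - 1. norm (\<Sum>\<alpha> | length \<alpha> = k. cmod (a \<alpha>) *\<^sub>R opword T \<alpha>)) \<le> 1)
   \<and> (\<forall>j\<ge>2. \<exists>!t. 0 < t \<and> fejer_sum j t = 1)
   \<and> (\<forall>j\<ge>2. 0 < bohr_gamma j \<and> fejer_sum j (bohr_gamma j) = 1)
   \<and> (\<forall>j\<ge>3. bohr_gamma j \<le> 1)
   \<and> strict_antimono_on {2..} bohr_gamma
   \<and> bohr_gamma \<longlonglongrightarrow> 1 / 2
    \<comment> \<open>(iii)\<close>
   \<and> (\<forall>T :: 'n \<Rightarrow> 'h bop. T \<in> row_ball (bohr_t m) \<longrightarrow>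
        (\<Sum>k=1..m - 1. norm (\<Sum>\<alpha> | length \<alpha> = k. cmod (cnj (a \<alpha>)) *\<^sub>R adj (opword T \<alpha>)))
          + cmod (a [])
          + (\<Sum>k=1..m - 1. norm (\<Sum>\<alpha> | length \<alpha> = k. cmod (a \<alpha>) *\<^sub>R opword T \<alpha>)) \<le> 1)
   \<and> (\<forall>j\<ge>2. \<exists>!t. 0 < t \<and> fejer_sum j t = 1 / 2)
   \<and> (\<forall>j\<ge>2. 0 < bohr_t j \<and> bohr_t j \<le> 1 \<and> fejer_sum j (bohr_t j) = 1 / 2)
   \<and> strict_antimono_on {2..} bohr_t
   \<and> bohr_t \<longlonglongrightarrow> 1 / 3
    \<comment> \<open>(iv) and (v)\<close>
   \<and> (\<forall>r :: real ^ 'n. (\<forall>i. 0 \<le> r $ i) \<longrightarrow>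
        (norm r \<le> bohr_gamma m \<longrightarrow>
          (\<Sum>k=0..m - 1. \<Sum>\<alpha> | length \<alpha> = k. cmod (a \<alpha>) * numword r \<alpha>) \<le> 1)
      \<and> (norm r \<le> bohr_t m \<longrightarrow>
          cmod (a []) + 2 * (\<Sum>k=1..m - 1. \<Sum>\<alpha> | length \<alpha> = k. cmod (a \<alpha>) * numword r \<alpha>) \<le> 1))"
proof -
  note sa = assms(3) and norm = assms(4)
  have coeff: "sqrt (\<Sum>\<alpha> | length \<alpha> = k. (cmod (a \<alpha>))\<^sup>2) \<le> (1 - cmod (a [])) * fejer_cos m k"
    if "k \<in> {1..m - 1}" for k
    using that toeplitz_poly_coeff_bound[OF sa norm, of k] by simp
  have gamma: "0 < bohr_gamma j \<and> fejer_sum j (bohr_gamma j) = 1" if "2 \<le> j" for j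
    unfolding bohr_gamma_def by (rule theI'[OF fejer_sum_solution[OF that]]) simp
  have t: "0 < bohr_t j \<and> fejer_sum j (bohr_t j) = 1 / 2" if "2 \<le> j" for j
    unfolding bohr_t_def by (rule theI'[OF fejer_sum_solution[OF that]]) simp
  let ?s = "\<lambda>k. sqrt (\<Sum>\<alpha> | length \<alpha> = k. (cmod (a \<alpha>))\<^sup>2)"
  have sum_gamma: "(\<Sum>k=1..m - 1. g k) \<le> 1 - cmod (a [])"
    if "\<And>k. g k \<le> bohr_gamma m ^ k * ?s k" for g
    using sum_fejer_weight_le[of m g "bohr_gamma m" a, OF that coeff] gamma[OF assms(1)] by simp
  have sum_t: "(\<Sum>k=1..m - 1. g k) \<le> (1 - cmod (a [])) / 2"
    if "\<And>k. g k \<le> bohr_t m ^ k * ?s k" for g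
    using sum_fejer_weight_le[of m g "bohr_t m" a, OF that coeff] t[OF assms(1)] by simp
  have head: "(\<Sum>k=0..m - 1. g k) = g 0 + (\<Sum>k=1..m - 1. g k)" for g :: "nat \<Rightarrow> real"
    by (simp add: sum.atLeast_Suc_atMost)
  have num: "(\<Sum>\<alpha> | length \<alpha> = k. cmod (a \<alpha>) * numword r \<alpha>) \<le> t ^ k * ?s k"
    if "norm r \<le> t" for r k t
    by (rule order_trans[OF sum_numword_le])
      (intro mult_right_mono power_mono that, simp_all add: sum_nonneg)
  show ?thesis
  proof (intro conjI allI impI)
    fix k assume "1 \<le> k \<and> k \<le> m - 1"
    then show "sqrt (\<Sum>\<alpha> | length \<alpha> = k. (cmod (a \<alpha>))\<^sup>2)
        \<le> (1 - cmod (a [])) * cos (pi / (real ((m - 1) div k) + 2))"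
      using coeff[of k] by (simp add: fejer_cos_def)
  next
    fix T :: "'n \<Rightarrow> 'h bop" assume T: "T \<in> row_ball (bohr_gamma m)"
    \<comment> \<open>Only an inequality is available for the degree 0 term, since the identity has
      norm 0 on the zero space.\<close>
    have "norm (cmod (a []) *\<^sub>R (1 :: 'h bop)) \<le> cmod (a [])"
      using mult_left_le[OF norm_one_bop_le norm_ge_zero[of "a []"]] by (simp add: mult.commute)
    then show "(\<Sum>k=0..m - 1. norm (\<Sum>\<alpha> | length \<alpha> = k. cmod (a \<alpha>) *\<^sub>R opword T \<alpha>)) \<le> 1"
      unfolding head using sum_gamma[OF norm_sum_opword_le[OF T]] by simp
  next
    fix T :: "'n \<Rightarrow> 'h bop" assume T: "T \<in> row_ball (bohr_t m)"
    show "(\<Sum>k=1..m - 1. norm (\<Sum>\<alpha> | length \<alpha> = k. cmod (cnj (a \<alpha>)) *\<^sub>R adj (opword T \<alpha>)))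
        + cmod (a [])
        + (\<Sum>k=1..m - 1. norm (\<Sum>\<alpha> | length \<alpha> = k. cmod (a \<alpha>) *\<^sub>R opword T \<alpha>)) \<le> 1"
      using sum_t[OF norm_sum_opword_le[OF T]] sum_t[OF norm_sum_opword_adj_le[OF T]] by simp
  next
    fix r :: "real ^ 'n" assume "norm r \<le> bohr_gamma m"
    from sum_gamma[OF num[OF this]]
    show "(\<Sum>k=0..m - 1. \<Sum>\<alpha> | length \<alpha> = k. cmod (a \<alpha>) * numword r \<alpha>) \<le> 1"
      unfolding head by (simp add: numword_def)
  next
    fix r :: "real ^ 'n" assume "norm r \<le> bohr_t m"
    from sum_t[OF num[OF this]]
    show "cmod (a []) + 2 * (\<Sum>k=1..m - 1. \<Sum>\<alpha> | length \<alpha> = k. cmod (a \<alpha>) * numword r \<alpha>) \<le> 1"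
      by simp
  next
    show "bohr_gamma \<longlonglongrightarrow> 1 / 2" using fejer_solution_tendsto[OF gamma] by simp
    show "bohr_t \<longlonglongrightarrow> 1 / 3" using fejer_solution_tendsto[OF t] by simp
    show "strict_antimono_on {2..} bohr_gamma" by (rule fejer_solution_antimono[OF gamma])
    show "strict_antimono_on {2..} bohr_t" by (rule fejer_solution_antimono[OF t])
  next
    fix j :: nat assume "2 \<le> j"
    then show "\<exists>!t. 0 < t \<and> fejer_sum j t = 1" "\<exists>!t. 0 < t \<and> fejer_sum j t = 1 / 2"
      by (rule fejer_sum_solution, simp)+
  next
    fix j :: nat assume "2 \<le> j"
    then show "bohr_t j \<le> 1" by (intro fejer_solution_le_one[OF t]) auto
  next
    fix j :: nat assume "3 \<le> j"
    then show "bohr_gamma j \<le> 1" by (intro fejer_solution_le_one[OF gamma]) auto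
  qed (simp_all add: gamma t)
qed

end
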